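(* For all integers $k \ge 2$, $p(Q_{2k-1} \setminus v) = p(Q_{2k-1} \setminus e) = k^2-1$.
   Context: For $n\ge 1$, $Q_n$ is the $n$-dimensional hypercube: the graph with vertex set $\{0,1\}^n$ and edges between vertices differing in exactly one coordinate. $Q_d\setminus v$ (respectively $Q_d\setminus e$) denotes the graph obtained from $Q_d$ by deleting one vertex together with its incident edges (respectively one edge); by symmetry it does not depend, up to isomorphism, on the choice. An embedding of a graph $G$ in $Q_n$ is any subgraph of $Q_n$ isomorphic to $G$. Given a set of $r$ colors, a $G$-polychromatic $r$-coloring of $Q_n$ is an assignment of one of the $r$ colors to each edge of $Q_n$ such that every embedding of $G$ in $Q_n$ contains an edge of every one of the $r$ colors. The polychromatic number $p(G)$ is the largest integer $r$ such that for every $n$ for which $Q_n$ contains an embedding of $G$, there is a $G$-polychromatic $r$-coloring of $Q_n$. *)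

theory Defs
  imports Main
begin

record 'a graph =
  verts :: "'a set"
  edges :: "'a set set"

definition simple_graph :: "'a graph \<Rightarrow> bool" where
  "simple_graph G \<longleftrightarrow> (\<forall>e\<in>edges G. e \<subseteq> verts G \<and> card e = 2)"

definition subgraph :: "'a graph \<Rightarrow> 'a graph \<Rightarrow> bool" where
  "subgraph H G \<longleftrightarrow> simple_graph H \<and> verts H \<subseteq> verts G \<and> edges H \<subseteq> edges G"

definition isomorphic :: "'a graph \<Rightarrow> 'b graph \<Rightarrow> bool" where
  "isomorphic G H \<longleftrightarrow>
     (\<exists>f. bij_betw f (verts G) (verts H) \<and>
          (\<forall>x\<in>verts G. \<forall>y\<in>verts G. {x, y} \<in> edges G \<longleftrightarrow> {f x, f y} \<in> edges H))"

definition delete_vertex :: "'a graph \<Rightarrow> 'a \<Rightarrow> 'a graph" where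
  "delete_vertex G v = \<lparr>verts = verts G - {v}, edges = {e \<in> edges G. v \<notin> e}\<rparr>"

definition delete_edge :: "'a graph \<Rightarrow> 'a set \<Rightarrow> 'a graph" where
  "delete_edge G e = \<lparr>verts = verts G, edges = edges G - {e}\<rparr>"

definition hypercube :: "nat \<Rightarrow> bool list graph" where
  "hypercube n =
     \<lparr>verts = {x. length x = n},
      edges = {{x, y} | x y. length x = n \<and> length y = n \<and> card {i. i < n \<and> x ! i \<noteq> y ! i} = 1}\<rparr>"

definition embedding :: "'a graph \<Rightarrow> nat \<Rightarrow> bool list graph \<Rightarrow> bool" where
  "embedding G n H \<longleftrightarrow> subgraph H (hypercube n) \<and> isomorphic G H"

text \<open>The colors are \<open>0, \<dots>, r - 1\<close>.\<close>

definition polychromatic_coloring ::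
    "'a graph \<Rightarrow> nat \<Rightarrow> nat \<Rightarrow> (bool list set \<Rightarrow> nat) \<Rightarrow> bool" where
  "polychromatic_coloring G n r c \<longleftrightarrow>
     (\<forall>e\<in>edges (hypercube n). c e < r) \<and>
     (\<forall>H. embedding G n H \<longrightarrow> (\<forall>i<r. \<exists>e\<in>edges H. c e = i))"

definition polychromatic :: "'a graph \<Rightarrow> nat \<Rightarrow> bool" where
  "polychromatic G r \<longleftrightarrow>
     (\<forall>n\<ge>1. (\<exists>H. embedding G n H) \<longrightarrow> (\<exists>c. polychromatic_coloring G n r c))"

text \<open>
  \<open>GREATEST\<close> is unspecified if there is no largest such number; by the lemmas
  below this does not happen for a graph with at least one edge that embeds in some hypercube.
\<close>

definition polychromatic_number :: "'a graph \<Rightarrow> nat" where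
  "polychromatic_number G = (GREATEST r. polychromatic G r)"

lemma finite_edges_hypercube: "finite (edges (hypercube n))"
proof -
  have "finite {x :: bool list. length x = n}"
    using finite_lists_length_eq[of "UNIV :: bool set" n] by simp
  moreover have "edges (hypercube n) \<subseteq> Pow {x. length x = n}"
    by (auto simp: hypercube_def)
  ultimately show ?thesis
    by (meson finite_Pow_iff finite_subset)
qed

lemma polychromatic_le_card_edges:
  assumes "embedding G n H" "n \<ge> 1" "polychromatic G r"
  shows "r \<le> card (edges H)"
proof -
  obtain c where c: "\<forall>i<r. \<exists>e\<in>edges H. c e = i"
    using assms unfolding polychromatic_def polychromatic_coloring_def by meson
  have fin: "finite (edges H)"
    using assms(1) finite_edges_hypercube finite_subset
    unfolding embedding_def subgraph_def by metis
  have "{..<r} \<subseteq> c ` edges H"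
    using c by auto
  then show ?thesis
    using surj_card_le[OF fin] by fastforce
qed

lemma polychromatic_one:
  assumes "simple_graph G" "edges G \<noteq> {}"
  shows "polychromatic G 1"
proof -
  obtain x y where xy: "{x, y} \<in> edges G" "x \<in> verts G" "y \<in> verts G"
    using assms unfolding simple_graph_def by (force simp: card_2_iff)
  have "edges H \<noteq> {}" if "embedding G n H" for n H
    using that xy unfolding embedding_def isomorphic_def by blast
  then have "polychromatic_coloring G n 1 (\<lambda>_. 0)" for n
    unfolding polychromatic_coloring_def by auto
  then show ?thesis
    unfolding polychromatic_def by blast
qed

lemma polychromatic_number_greatest:
  assumes "simple_graph G" "edges G \<noteq> {}" "embedding G n H" "n \<ge> 1"
  shows "polychromatic G (polychromatic_number G)"
    and "polychromatic G r \<Longrightarrow> r \<le> polychromatic_number G"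
  unfolding polychromatic_number_def
  using polychromatic_one[OF assms(1,2)] polychromatic_le_card_edges[OF assms(3,4)]
  by (blast intro: GreatestI_nat Greatest_le_nat)+

end

theory Submission
  imports Defs "HOL-Library.Ramsey" "HOL-Combinatorics.Transposition"
begin

text \<open>
  Write \<open>k = m + 1\<close> and call the \<open>2 m + 1\<close> free coordinates of a subcube its stars. An edge
  in the direction of coordinate \<open>i\<close> has \<open>l\<close> ones to the left and \<open>r\<close> ones to the right of \<open>i\<close>.

  Lower bound: give the edge the color \<open>k l + r\<close> modulo \<open>k\<^sup>2 - 1\<close>. The edges in the direction of
  the middle star realize all pairs of a \<open>k \<times> k\<close> square and hence all colors; only the color of
  the corner \<open>(0, m)\<close> or \<open>(m, 0)\<close> can be lost with the deleted vertex, and only if that vertex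
  is constant with opposite values on the two halves of the stars. The lost color differs from that of
  the base point by a multiple of \<open>m\<close>, and such colors are realized by one of the two neighbouring
  stars, whose base points also differ by a multiple of \<open>m\<close>.

  Upper bound: by Ramsey's theorem we may assume that the color of an edge depends only on \<open>(l, r)\<close>. A
  subcube then corresponds to a sequence of rectangles of sizes \<open>j \<times> (2 k - j)\<close> moving along an antidiagonal
  of the grid. If every subcube contains each of \<open>k\<^sup>2\<close> colors, then on a long segment each color is
  hit by all rectangles of one size. Counting forces this size to be \<open>k \<times> k\<close> for some color that
  occurs in some square only at the corner \<open>(0, m)\<close>, while the other rectangles can be chosen to avoid
  it. Deleting the edge of that corner destroys the color.
\<close>

section \<open>Edges and subcubes\<close>

definition vec :: "nat \<Rightarrow> nat set \<Rightarrow> bool list" where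
  "vec n X = map (\<lambda>i. i \<in> X) [0..<n]"

text \<open>Meant for \<open>i \<notin> X\<close>, so that \<open>X\<close> is the lower end: the
  ones left and right of the direction \<open>i\<close> can then be counted in \<open>X\<close>
  alone.\<close>

definition cube_edge :: "nat \<Rightarrow> nat \<Rightarrow> nat set \<Rightarrow> bool list set" where
  "cube_edge n i X = {vec n X, vec n (insert i X)}"

lemma length_vec [simp]: "length (vec n X) = n"
  by (simp add: vec_def)

lemma nth_vec [simp]: "i < n \<Longrightarrow> vec n X ! i \<longleftrightarrow> i \<in> X"
  by (simp add: vec_def)

lemma vec_eq_iff:
  assumes "X \<subseteq> {..<n}" "Y \<subseteq> {..<n}"
  shows "vec n X = vec n Y \<longleftrightarrow> X = Y"
proof
  assume "vec n X = vec n Y"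
  then have "i \<in> X \<longleftrightarrow> i \<in> Y" if "i < n" for i
    using nth_vec that by metis
  then show "X = Y"
    using assms by blast
qed auto

lemma vec_Collect_nth: "length x = n \<Longrightarrow> vec n {i. i < n \<and> x ! i} = x"
  by (auto simp: list_eq_iff_nth_eq)

lemma vec_diff:
  assumes "X \<subseteq> {..<n}" "Y \<subseteq> {..<n}"
  shows "{i. i < n \<and> vec n X ! i \<noteq> vec n Y ! i} = sym_diff X Y"
  using assms by auto

lemma doubleton_vec_in_edges_iff:
  assumes "X \<subseteq> {..<n}" "Y \<subseteq> {..<n}"
  shows "{vec n X, vec n Y} \<in> edges (hypercube n) \<longleftrightarrow> (\<exists>i. sym_diff X Y = {i})"
proof -
  have "{vec n X, vec n Y} \<in> edges (hypercube n) \<longleftrightarrow> card (sym_diff X Y) = 1"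
  proof
    assume "{vec n X, vec n Y} \<in> edges (hypercube n)"
    then obtain x y where xy: "{vec n X, vec n Y} = {x, y}"
      "card {i. i < n \<and> x ! i \<noteq> y ! i} = 1"
      unfolding hypercube_def by auto
    from xy(1) have "x = vec n X \<and> y = vec n Y \<or> x = vec n Y \<and> y = vec n X"
      by (auto simp: doubleton_eq_iff)
    then have "{i. i < n \<and> x ! i \<noteq> y ! i} = sym_diff X Y"
    proof
      assume "x = vec n X \<and> y = vec n Y"
      then show ?thesis
        using vec_diff[OF assms] by simp
    next
      assume "x = vec n Y \<and> y = vec n X"
      then show ?thesis
        using vec_diff[OF assms(2) assms(1)] by (simp add: Un_commute)
    qed
    then show "card (sym_diff X Y) = 1"
      using xy(2) by simp
  next
    assume "card (sym_diff X Y) = 1"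
    then show "{vec n X, vec n Y} \<in> edges (hypercube n)"
      unfolding vec_diff[OF assms, symmetric] hypercube_def graph.simps mem_Collect_eq
      using length_vec by blast
  qed
  then show ?thesis
    by (simp add: card_1_singleton_iff)
qed

lemma cube_edge_in_edges:
  assumes "i < n" "X \<subseteq> {..<n}" "i \<notin> X"
  shows "cube_edge n i X \<in> edges (hypercube n)"
proof -
  have "sym_diff X (insert i X) = {i}"
    using assms by auto
  then show ?thesis
    using assms doubleton_vec_in_edges_iff[of X n "insert i X"] by (auto simp: cube_edge_def)
qed

lemma edges_hypercubeE:
  assumes "e \<in> edges (hypercube n)"
  obtains i X where "i < n" "X \<subseteq> {..<n}" "i \<notin> X" "e = cube_edge n i X"
proof -
  obtain x y where xy: "e = {x, y}" "length x = n" "length y = n"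
    using assms unfolding hypercube_def by auto
  define X Y where "X = {i. i < n \<and> x ! i}" and "Y = {i. i < n \<and> y ! i}"
  have sub: "X \<subseteq> {..<n}" "Y \<subseteq> {..<n}"
    by (auto simp: X_def Y_def)
  have e: "e = {vec n X, vec n Y}"
    using xy by (simp add: X_def Y_def vec_Collect_nth)
  then obtain i where i: "sym_diff X Y = {i}"
    using assms doubleton_vec_in_edges_iff[OF sub] by auto
  then have diff: "(x \<in> X) \<noteq> (x \<in> Y) \<longleftrightarrow> x = i" for x
    by (auto simp: set_eq_iff)
  then have "i < n"
    using sub by blast
  show ?thesis
  proof (cases "i \<in> X")
    case True
    then have "x \<in> X \<longleftrightarrow> x \<in> insert i Y" "i \<notin> Y" for x
      using diff[of x] diff[of i] by auto
    then have "X = insert i Y" "i \<notin> Y"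
      by blast+
    then show ?thesis
      using that[of i Y] \<open>i < n\<close> sub e by (simp add: cube_edge_def insert_commute)
  next
    case False
    then have "x \<in> Y \<longleftrightarrow> x \<in> insert i X" for x
      using diff[of x] diff[of i] by auto
    then have "Y = insert i X"
      by blast
    then show ?thesis
      using that[of i X] False \<open>i < n\<close> sub e by (simp add: cube_edge_def)
  qed
qed

lemma cube_edge_inject:
  assumes "X \<subseteq> {..<n}" "i < n" "i \<notin> X" "Y \<subseteq> {..<n}" "j < n" "j \<notin> Y"
    and "cube_edge n i X = cube_edge n j Y"
  shows "i = j \<and> X = Y"
proof -
  have "X = Y \<and> insert i X = insert j Y \<or> X = insert j Y \<and> insert i X = Y"
    using assms by (auto simp: cube_edge_def doubleton_eq_iff vec_eq_iff)
  then show ?thesis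
    using assms by blast
qed

lemma simple_hypercube: "simple_graph (hypercube n)"
  unfolding simple_graph_def
proof
  fix e assume "e \<in> edges (hypercube n)"
  then obtain i X where "i < n" "X \<subseteq> {..<n}" "i \<notin> X" "e = cube_edge n i X"
    by (rule edges_hypercubeE)
  moreover from this have "vec n X \<noteq> vec n (insert i X)"
    by (subst vec_eq_iff) auto
  ultimately show "e \<subseteq> verts (hypercube n) \<and> card e = 2"
    by (auto simp: cube_edge_def hypercube_def)
qed

text \<open>\<open>B\<close> holds the coordinates fixed to 1, \<open>\<rho>\<close> places the
  stars and \<open>u\<close> reflects them. As \<open>\<rho>\<close> need not be increasing, a
  chosen edge of the small cube can be sent to any chosen edge of the subcube.\<close>

definition subcube_map ::
    "nat \<Rightarrow> nat set \<Rightarrow> (nat \<Rightarrow> nat) \<Rightarrow> (nat \<Rightarrow> bool) \<Rightarrow> nat \<Rightarrow> bool list \<Rightarrow> bool list" where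
  "subcube_map n B \<rho> u d x = vec n (B \<union> \<rho> ` {t. t < d \<and> x ! t \<noteq> u t})"

text \<open>Reflecting the direction \<open>j\<close> of an edge only swaps its two ends, so
  \<open>u j\<close> does not enter the result.\<close>

lemma image_subcube_map:
  assumes "j < d" "X \<subseteq> {..<d}" "j \<notin> X"
  shows "subcube_map n B \<rho> u d ` cube_edge d j X =
    cube_edge n (\<rho> j) (B \<union> \<rho> ` {t. t < d \<and> t \<noteq> j \<and> (t \<in> X) \<noteq> u t})"
proof -
  let ?Y = "{t. t < d \<and> t \<noteq> j \<and> (t \<in> X) \<noteq> u t}"
  have "{t. t < d \<and> vec d X ! t \<noteq> u t} = (if u j then insert j ?Y else ?Y)"
    using assms by auto
  then have 1: "B \<union> \<rho> ` {t. t < d \<and> vec d X ! t \<noteq> u t} =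
      (if u j then insert (\<rho> j) (B \<union> \<rho> ` ?Y) else B \<union> \<rho> ` ?Y)"
    by (cases "u j") (simp_all only: if_True if_False image_insert Un_insert_right)
  have "{t. t < d \<and> vec d (insert j X) ! t \<noteq> u t} = (if u j then ?Y else insert j ?Y)"
    using assms by auto
  then have 2: "B \<union> \<rho> ` {t. t < d \<and> vec d (insert j X) ! t \<noteq> u t} =
      (if u j then B \<union> \<rho> ` ?Y else insert (\<rho> j) (B \<union> \<rho> ` ?Y))"
    by (cases "u j") (simp_all only: if_True if_False image_insert Un_insert_right)
  show ?thesis
    unfolding cube_edge_def subcube_map_def image_insert image_empty 1 2
    by (cases "u j") (simp_all only: if_True if_False insert_commute)
qed

lemma embedding_subcube_map:
  fixes n d B \<rho> u
  defines "\<phi> \<equiv> subcube_map n B \<rho> u d"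
  assumes B: "B \<subseteq> {..<n}" and inj: "inj_on \<rho> {..<d}" and ran: "\<rho> ` {..<d} \<subseteq> {..<n} - B"
    and G: "subgraph G (hypercube d)"
  shows "embedding G n \<lparr>verts = \<phi> ` verts G, edges = (`) \<phi> ` edges G\<rparr>"
proof -
  let ?H = "\<lparr>verts = \<phi> ` verts G, edges = (`) \<phi> ` edges G\<rparr>"
  have vG: "verts G \<subseteq> {x. length x = d}" and eG: "edges G \<subseteq> edges (hypercube d)"
    and sG: "\<And>e. e \<in> edges G \<Longrightarrow> e \<subseteq> verts G \<and> card e = 2"
    using G unfolding subgraph_def simple_graph_def by (auto simp: hypercube_def)
  have inj_phi: "inj_on \<phi> (verts G)"
  proof (rule inj_onI)
    fix x y assume xy: "x \<in> verts G" "y \<in> verts G" "\<phi> x = \<phi> y"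
    let ?X = "{t. t < d \<and> x ! t \<noteq> u t}" and ?Y = "{t. t < d \<and> y ! t \<noteq> u t}"
    have "B \<union> \<rho> ` ?X = B \<union> \<rho> ` ?Y"
      using xy(3) unfolding \<phi>_def subcube_map_def
      by (subst (asm) vec_eq_iff) (use B ran in auto)
    moreover have "B \<inter> \<rho> ` ?X = {}" "B \<inter> \<rho> ` ?Y = {}"
      using ran by auto
    ultimately have "\<rho> ` ?X = \<rho> ` ?Y"
      by blast
    then have "?X = ?Y"
      by (subst (asm) inj_on_image_eq_iff[OF inj]) auto
    then have "x ! t = y ! t" if "t < d" for t
      using that by (auto simp: set_eq_iff)
    then show "x = y"
      using xy vG by (auto simp: list_eq_iff_nth_eq)
  qed
  have "simple_graph ?H"
    unfolding simple_graph_def using sG inj_phi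
    by (auto simp: card_image inj_on_subset)
  moreover have "edges ?H \<subseteq> edges (hypercube n)"
  proof
    fix h assume "h \<in> edges ?H"
    then obtain e where e: "e \<in> edges G" "h = \<phi> ` e"
      by auto
    then obtain j X where jX: "j < d" "X \<subseteq> {..<d}" "j \<notin> X" "e = cube_edge d j X"
      using eG edges_hypercubeE by blast
    let ?Y = "{t. t < d \<and> t \<noteq> j \<and> (t \<in> X) \<noteq> u t}"
    have "\<rho> j \<notin> \<rho> ` ?Y"
      using jX inj by (auto simp: inj_on_def)
    then have "\<rho> j \<notin> B \<union> \<rho> ` ?Y"
      using ran jX by auto
    then show "h \<in> edges (hypercube n)"
      using e jX B ran unfolding \<phi>_def by (auto simp: image_subcube_map intro!: cube_edge_in_edges)
  qed
  moreover have "verts ?H \<subseteq> verts (hypercube n)"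
    by (auto simp: hypercube_def \<phi>_def subcube_map_def)
  moreover have "isomorphic G ?H"
    unfolding isomorphic_def
  proof (intro exI conjI ballI)
    show "bij_betw \<phi> (verts G) (verts ?H)"
      using inj_phi by (simp add: bij_betw_def)
    fix x y assume xy: "x \<in> verts G" "y \<in> verts G"
    have "{x, y} \<in> edges G" if e: "e \<in> edges G" "{\<phi> x, \<phi> y} = \<phi> ` e" for e
    proof -
      have "\<phi> ` {x, y} = \<phi> ` e"
        using e by simp
      then have "{x, y} = e"
        by (subst (asm) inj_on_image_eq_iff[OF inj_phi]) (use xy sG[OF e(1)] in auto)
      then show ?thesis
        using e by simp
    qed
    moreover have "{\<phi> x, \<phi> y} \<in> (`) \<phi> ` edges G" if "{x, y} \<in> edges G"
      using imageI[OF that, of "(`) \<phi>"] by simp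
    ultimately show "{x, y} \<in> edges G \<longleftrightarrow> {\<phi> x, \<phi> y} \<in> edges ?H"
      unfolding graph.simps by blast
  qed
  ultimately show ?thesis
    unfolding embedding_def subgraph_def by blast
qed

section \<open>Embeddings of a punctured cube\<close>

text \<open>Two vertices of a hypercube at distance 2 have exactly two common neighbours. This is
  the source of the rigidity of embeddings below.\<close>

lemma common_neighbour:
  assumes "sym_diff E (sym_diff C {p}) = {s}" "sym_diff E (sym_diff C {q}) = {t}" "p \<noteq> q"
  shows "E = C \<or> E = sym_diff C {p, q}"
proof -
  have E1: "x \<in> E \<longleftrightarrow> ((x \<in> C) = ((x = p) = (x = s)))" for x
    using assms(1) by (auto simp: set_eq_iff)
  have E2: "x \<in> E \<longleftrightarrow> ((x \<in> C) = ((x = q) = (x = t)))" for x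
    using assms(2) by (auto simp: set_eq_iff)
  show ?thesis
  proof (cases "s = p")
    case True
    then have "x \<in> E \<longleftrightarrow> x \<in> C" for x
      using E1[of x] by auto
    then show ?thesis
      by blast
  next
    case False
    then have "p = t"
      using E1[of p] E2[of p] assms(3) by auto
    then have "s = q"
      using E1[of s] E2[of s] False by auto
    then have "x \<in> E \<longleftrightarrow> x \<in> sym_diff C {p, q}" for x
      using E1[of x] assms(3) by auto
    then show ?thesis
      by blast
  qed
qed

lemma sym_diff_insert: "p \<notin> S \<Longrightarrow> sym_diff A (insert p S) = sym_diff (sym_diff A S) {p}"
  by auto

text \<open>Positions are forced upwards: the image of a set containing \<open>a\<close> and
  \<open>b\<close> is a common neighbour of the images of the sets lacking one of them, and
  injectivity excludes the position taken by the set lacking both. Hence the image fills a subcube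
  with directions \<open>D\<close>, except for the place \<open>W\<close> where the deleted vertex
  would go.\<close>

lemma punctured_cube_rigid:
  fixes f :: "bool list \<Rightarrow> bool list"
  assumes d: "d \<ge> 2" and v: "length v = d"
    and inj: "inj_on f ({x. length x = d} - {v})"
    and len: "\<And>x. length x = d \<Longrightarrow> x \<noteq> v \<Longrightarrow> length (f x) = n"
    and hom: "\<And>e. e \<in> edges (hypercube d) \<Longrightarrow> v \<notin> e \<Longrightarrow> f ` e \<in> E"
    and E: "E \<subseteq> edges (hypercube n)"
  obtains D W where "D \<subseteq> {..<n}" "card D = d" "W \<subseteq> {..<n}"
    "\<And>Z i. Z \<subseteq> {..<n} \<Longrightarrow> i \<in> D \<Longrightarrow> i \<notin> Z \<Longrightarrow> Z - D = W - D \<Longrightarrow> Z \<noteq> W \<Longrightarrow> insert i Z \<noteq> W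
      \<Longrightarrow> cube_edge n i Z \<in> E"
proof -
  \<comment> \<open>Taking the antipode of \<open>v\<close> as the origin, \<open>v\<close> becomes the full set, so that \<open>v\<close> is never
    needed when the position of a vertex is derived from the vertices below it.\<close>
  define U where "U = {j. j < d \<and> \<not> v ! j}"
  define g where "g X = vec d (sym_diff U X)" for X
  define F where "F X = {i. i < n \<and> f (g X) ! i}" for X
  have sub: "sym_diff U X \<subseteq> {..<d}" if "X \<subseteq> {..<d}" for X
    using that by (auto simp: U_def)
  have g_inj: "X = Y" if "X \<subseteq> {..<d}" "Y \<subseteq> {..<d}" "g X = g Y" for X Y
  proof -
    have "sym_diff U X = sym_diff U Y"
      using that sub vec_eq_iff unfolding g_def by metis
    then have "x \<in> X \<longleftrightarrow> x \<in> Y" for x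
      by (auto simp: set_eq_iff)
    then show ?thesis
      by blast
  qed
  have "sym_diff U {..<d} = {j. j < d \<and> v ! j}"
    by (auto simp: U_def)
  then have "g {..<d} = v"
    unfolding g_def using v by (simp add: vec_Collect_nth)
  then have g_ne: "g X \<noteq> v" if "X \<subset> {..<d}" for X
    using that g_inj[of X "{..<d}"] by (auto simp: psubset_eq)
  have vec_F: "vec n (F X) = f (g X)" if "X \<subset> {..<d}" for X
    unfolding F_def using that g_ne len[of "g X"] by (simp add: vec_Collect_nth g_def)
  have F_sub: "F X \<subseteq> {..<n}" for X
    by (auto simp: F_def)
  have F_inj: "X = Y" if "X \<subset> {..<d}" "Y \<subset> {..<d}" "F X = F Y" for X Y
  proof -
    have "f (g X) = f (g Y)"
      using that vec_F by metis
    then have "g X = g Y"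
      using that g_ne inj_onD[OF inj, of "g X" "g Y"] by (simp add: g_def)
    then show ?thesis
      using g_inj that by blast
  qed
  have edge: "{vec n (F X), vec n (F (insert j X))} \<in> E" if "insert j X \<subset> {..<d}" "j \<notin> X" for j X
  proof -
    have X: "X \<subset> {..<d}"
      using that by blast
    have "sym_diff (sym_diff U X) (sym_diff U (insert j X)) = {j}"
      using that by auto
    then have "{g X, g (insert j X)} \<in> edges (hypercube d)"
      unfolding g_def using that X sub by (subst doubleton_vec_in_edges_iff) auto
    then have "f ` {g X, g (insert j X)} \<in> E"
      using hom[of "{g X, g (insert j X)}"] g_ne[OF X] g_ne[OF that(1)] by auto
    then show ?thesis
      using vec_F that X by simp
  qed
  have adj: "\<exists>i. sym_diff (F X) (F (insert j X)) = {i}" if "insert j X \<subset> {..<d}" "j \<notin> X" for j X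
    using edge[OF that] E doubleton_vec_in_edges_iff[OF F_sub F_sub] by blast
  have single: "{j} \<subset> {..<d}" if "j < d" for j
  proof -
    have "{j} \<noteq> {..<d}"
      using d by (metis One_nat_def card_lessThan is_singletonI is_singleton_altdef not_less_eq_eq numeral_2_eq_2 order_refl)
    then show ?thesis
      using that by blast
  qed
  \<comment> \<open>The edges at the origin fix the directions: coordinate \<open>j\<close> of the
    small cube becomes coordinate \<open>\<rho> j\<close>.\<close>
  define \<rho> where "\<rho> j = (THE i. sym_diff (F {}) (F {j}) = {i})" for j
  have \<rho>: "sym_diff (F {}) (F {j}) = {\<rho> j}" if "j < d" for j
  proof -
    obtain i where "sym_diff (F {}) (F {j}) = {i}"
      using adj[of j "{}"] single[OF \<open>j < d\<close>] by auto
    then show ?thesis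
      unfolding \<rho>_def by simp
  qed
  have F_single: "F {j} = sym_diff (F {}) {\<rho> j}" if "j < d" for j
    using \<rho>[OF that] by auto
  have \<rho>_inj: "inj_on \<rho> {..<d}"
    using F_single F_inj single by (intro inj_onI) (metis lessThan_iff singleton_inject)
  have F_eq: "F X = sym_diff (F {}) (\<rho> ` X)" if "X \<subset> {..<d}" for X
    using that
  proof (induction "card X" arbitrary: X rule: less_induct)
    case less
    have fin: "finite X"
      using less.prems finite_subset by blast
    consider "X = {}" | j where "X = {j}" | a b Y where "X = insert a (insert b Y)" "a \<noteq> b" "a \<notin> Y" "b \<notin> Y"
    proof (cases "\<exists>j. X \<subseteq> {j}")
      case True
      then show thesis
        using that(1,2) by (metis subset_singletonD)
    next
      case False
      then obtain a where a: "a \<in> X"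
        by blast
      with False obtain b where b: "b \<in> X" "b \<noteq> a"
        by blast
      have "X = insert a (insert b (X - {a, b}))"
        using a b by blast
      then show thesis
        using that(3)[of a b "X - {a, b}"] b by blast
    qed
    then show ?case
    proof cases
      case 1
      then show ?thesis by simp
    next
      case 2
      then show ?thesis
        using F_single less.prems by auto
    next
      case 3
      define C where "C = sym_diff (F {}) (\<rho> ` Y)"
      have sub3: "insert a Y \<subset> {..<d}" "insert b Y \<subset> {..<d}" "Y \<subset> {..<d}"
        using 3 less.prems by auto
      have \<rho>ab: "\<rho> a \<notin> \<rho> ` Y" "\<rho> b \<notin> \<rho> ` Y" "\<rho> a \<noteq> \<rho> b"
        using 3 less.prems \<rho>_inj unfolding inj_on_def by blast+
      have card: "card (insert a Y) < card X" "card (insert b Y) < card X" "card Y < card X"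
        using 3 fin by auto
      have "F (insert a Y) = sym_diff C {\<rho> a}"
        using less.hyps[OF card(1) sub3(1)] unfolding C_def
        by (simp only: image_insert sym_diff_insert[OF \<rho>ab(1)])
      moreover have "F (insert b Y) = sym_diff C {\<rho> b}"
        using less.hyps[OF card(2) sub3(2)] unfolding C_def
        by (simp only: image_insert sym_diff_insert[OF \<rho>ab(2)])
      moreover have "F Y = C"
        using less.hyps[OF card(3) sub3(3)] unfolding C_def by simp
      moreover have "\<exists>s. sym_diff (F X) (F (insert a Y)) = {s}"
        using adj[of b "insert a Y"] 3 less.prems by (simp add: Un_commute insert_commute)
      moreover have "\<exists>t. sym_diff (F X) (F (insert b Y)) = {t}"
        using adj[of a "insert b Y"] 3 less.prems by (simp add: Un_commute)
      ultimately have "F X = F Y \<or> F X = sym_diff C {\<rho> a, \<rho> b}"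
        using common_neighbour[of "F X" C "\<rho> a"] \<rho>ab by metis
      moreover have "F X \<noteq> F Y"
        using F_inj[OF less.prems sub3(3)] 3 by blast
      ultimately have "F X = sym_diff C {\<rho> a, \<rho> b}"
        by blast
      also have "\<dots> = sym_diff (F {}) (\<rho> ` X)"
        using sym_diff_insert[of "\<rho> a" "{\<rho> b}" C] \<rho>ab
          sym_diff_insert[of "\<rho> a" "insert (\<rho> b) (\<rho> ` Y)" "F {}"]
          sym_diff_insert[OF \<rho>ab(2), of "F {}"]
        unfolding 3(1) image_insert C_def by (metis insert_iff empty_iff)
      finally show ?thesis .
    qed
  qed
  define D where "D = \<rho> ` {..<d}"
  define W where "W = sym_diff (F {}) D"
  have "\<rho> j < n" if "j < d" for j
  proof -
    have "\<rho> j \<in> sym_diff (F {}) (F {j})"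
      unfolding \<rho>[OF that] by simp
    then show ?thesis
      using F_sub[of "{}"] F_sub[of "{j}"] by auto
  qed
  then have D_sub: "D \<subseteq> {..<n}"
    by (auto simp: D_def)
  show thesis
  proof
    show "D \<subseteq> {..<n}"
      by fact
    show "card D = d"
      using \<rho>_inj by (simp add: D_def card_image)
    show "W \<subseteq> {..<n}"
      using D_sub F_sub[of "{}"] unfolding W_def by auto
    fix Z i
    assume Z: "Z \<subseteq> {..<n}" "i \<in> D" "i \<notin> Z" "Z - D = W - D" "Z \<noteq> W" "insert i Z \<noteq> W"
    define X where "X = {j. j < d \<and> \<rho> j \<in> sym_diff Z (F {})}"
    obtain j where j: "j < d" "i = \<rho> j"
      using Z(2) by (auto simp: D_def)
    have mem: "x \<in> Z \<longleftrightarrow> x \<in> F {}" if "x \<notin> D" for x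
      using Z(4) that unfolding W_def by blast
    have img: "\<rho> ` X = sym_diff Z (F {})"
    proof (rule set_eqI)
      fix x
      show "x \<in> \<rho> ` X \<longleftrightarrow> x \<in> sym_diff Z (F {})"
      proof (cases "x \<in> D")
        case True
        then obtain t where "t < d" "x = \<rho> t"
          by (auto simp: D_def)
        then show ?thesis
          unfolding X_def using \<rho>_inj unfolding inj_on_def by blast
      next
        case False
        then show ?thesis
          using mem[OF False] by (auto simp: X_def D_def)
      qed
    qed
    have Z_eq: "Z = sym_diff (F {}) (\<rho> ` X)"
      unfolding img by auto
    have X_sub: "X \<subseteq> {..<d}"
      by (auto simp: X_def)
    have "X \<noteq> {..<d}"
      using Z(5) Z_eq unfolding W_def D_def by metis
    then have X: "X \<subset> {..<d}"
      using X_sub by blast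
    have j_mem: "\<rho> j \<in> \<rho> ` A \<longleftrightarrow> j \<in> A" if "A \<subseteq> {..<d}" for A
      using that j \<rho>_inj by (meson inj_on_image_mem_iff lessThan_iff)
    \<comment> \<open>The lower end \<open>Z\<close> is the image of the larger of the two sets
      exactly if \<open>F {}\<close> has a one at \<open>i\<close>, since moving away from
      \<open>F {}\<close> then turns that one off.\<close>
    show "cube_edge n i Z \<in> E"
    proof (cases "j \<in> X")
      case False
      have "i \<notin> F {}"
        using False j_mem[OF X_sub] Z(3) img j by blast
      then have ins: "insert i Z = sym_diff (F {}) (\<rho> ` insert j X)"
        using Z_eq j by auto
      then have "insert j X \<noteq> {..<d}"
        using Z(6) unfolding W_def D_def by metis
      then have "insert j X \<subset> {..<d}"
        using X_sub j by blast
      then show ?thesis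
        using edge[of j X] False Z_eq ins F_eq[OF X] F_eq[of "insert j X"]
        by (simp add: cube_edge_def)
    next
      case True
      have i: "i \<in> F {}"
        using True j_mem[OF X_sub] Z(3) img j by blast
      have X': "X - {j} \<subset> {..<d}" "insert j (X - {j}) = X"
        using X True by auto
      have "\<rho> ` (X - {j}) = \<rho> ` X - {i}"
        using inj_on_image_set_diff[OF \<rho>_inj, of X "{j}"] X_sub j by auto
      then have "insert i Z = sym_diff (F {}) (\<rho> ` (X - {j}))"
        using Z_eq i by auto
      then show ?thesis
        using edge[of j "X - {j}"] X X' Z_eq F_eq[OF X] F_eq[of "X - {j}"]
        by (simp add: cube_edge_def insert_commute)
    qed
  qed
qed

section \<open>The lower bound\<close>

text \<open>Exchanging one element gives a second set of the same size, so \<open>V\<close> can be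
  avoided; only at the sizes 0 and \<open>card S\<close> is the set forced.\<close>

lemma obtain_subset_neq:
  assumes "finite S" "l \<le> card S" "V \<noteq> {} \<or> l \<noteq> 0" "V \<noteq> S \<or> l \<noteq> card S"
  obtains B where "B \<subseteq> S" "card B = l" "B \<noteq> V"
proof (cases "l = 0 \<or> l = card S")
  case True
  then show ?thesis
    using assms that[of "{}"] that[of S] by fastforce
next
  case False
  obtain B where B: "B \<subseteq> S" "card B = l" "finite B"
    using obtain_subset_with_card_n[OF assms(2)] by blast
  obtain x where x: "x \<in> B"
    using B False by fastforce
  obtain y where y: "y \<in> S" "y \<notin> B"
    using B False assms by (metis card_subset_eq subsetI subset_antisym)
  have "card (insert y (B - {x})) = l"
    using B x y by (metis Diff_iff card_Suc_Diff1 card_insert_disjoint finite_Diff)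
  moreover have "insert y (B - {x}) \<noteq> B" "insert y (B - {x}) \<subseteq> S"
    using B y by auto
  ultimately show ?thesis
    using that B by metis
qed

section \<open>Multiples of \<open>m\<close> modulo \<open>m * (m + 2)\<close> in boxes\<close>

lemma residue_reduce:
  fixes m :: nat and t :: int
  assumes "m \<ge> 1"
  obtains s where "s \<le> m + 1" "m * s < m * (m + 2)"
    "(int m * t) mod int (m * (m + 2)) = int (m * s)"
proof
  define s where "s = nat (t mod int (m + 2))"
  have "int s = t mod int (m + 2)"
    by (simp add: s_def)
  then show "(int m * t) mod int (m * (m + 2)) = int (m * s)"
    by (simp only: of_nat_mult mult_mod_right)
  have "int s < int (m + 2)"
    unfolding \<open>int s = _\<close> by (rule pos_mod_bound) simp
  then show "s \<le> m + 1"
    by simp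
  then show "m * s < m * (m + 2)"
    using assms by (intro mult_strict_left_mono) auto
qed

text \<open>The box belongs to the star just before the middle one. The identity
  \<open>m * (q + 1) = (m + 1) * q + (m - q)\<close> leaves it only at \<open>q = m\<close>, where
  lowering \<open>l\<close> by one and raising \<open>r\<close> by \<open>m + 1\<close>
  helps.\<close>

lemma residue_in_tall_box:
  fixes m :: nat and t :: int
  assumes "m \<ge> 1"
  obtains l r where "l \<le> m - 1" "r \<le> m + 1"
    "int ((m + 1) * l + r) mod int (m * (m + 2)) = (int m * t) mod int (m * (m + 2))"
proof -
  obtain s where s: "s \<le> m + 1" "m * s < m * (m + 2)"
    "(int m * t) mod int (m * (m + 2)) = int (m * s)"
    using residue_reduce[OF assms] by blast
  have "\<exists>l r. l \<le> m - 1 \<and> r \<le> m + 1 \<and> (m + 1) * l + r = m * s"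
  proof -
    have "s = 0 \<or> s = m + 1 \<or> (\<exists>q. s = Suc q \<and> q < m)"
      using s(1) by (cases s) auto
    then consider "s = 0" | "s = m + 1" | q where "s = Suc q" "q < m"
      by blast
    then show ?thesis
    proof cases
      case 1
      then show ?thesis
        by (intro exI[of _ 0]) auto
    next
      case 2
      have "(m + 1) * (m - 1) + (m + 1) = m * s"
        using assms 2 by (cases m) (simp_all add: algebra_simps)
      then show ?thesis
        by blast
    next
      case 3
      then obtain c where "m = Suc q + c"
        by (metis Suc_leI le_iff_add)
      then have "(m + 1) * q + (m - q) = m * s"
        using 3 by (simp add: algebra_simps)
      then show ?thesis
        using 3 by (intro exI[of _ q] exI[of _ "m - q"]) auto
    qed
  qed
  then show thesis
    using that s by (metis mod_less of_nat_mod)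
qed

text \<open>The box belongs to the star just after the middle one. The identity
  \<open>m * (q + 1) = (m + 1) * q + (m - q)\<close> violates the bound on \<open>r\<close> only at
  \<open>q = 0\<close>; the residue \<open>m\<close> is instead reached by wrapping around once,
  from \<open>(m + 1) * (m + 1) + (m - 1)\<close>.\<close>

lemma residue_in_wide_box:
  fixes m :: nat and t :: int
  assumes "m \<ge> 1"
  obtains l r where "l \<le> m + 1" "r \<le> m - 1"
    "int ((m + 1) * l + r) mod int (m * (m + 2)) = (int m * t) mod int (m * (m + 2))"
proof -
  obtain s where s: "s \<le> m + 1" "m * s < m * (m + 2)"
    "(int m * t) mod int (m * (m + 2)) = int (m * s)"
    using residue_reduce[OF assms] by blast
  have "\<exists>l r. l \<le> m + 1 \<and> r \<le> m - 1 \<and> ((m + 1) * l + r) mod (m * (m + 2)) = m * s"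
  proof -
    have "s = 0 \<or> s = 1 \<or> (\<exists>q. s = Suc q \<and> q \<le> m \<and> 1 \<le> q)"
      using s(1) by (cases s) auto
    then consider "s = 0" | "s = 1" | q where "s = Suc q" "q \<le> m" "1 \<le> q"
      by blast
    then show ?thesis
    proof cases
      case 1
      then show ?thesis
        by (intro exI[of _ 0]) auto
    next
      case 2
      have "(m + 1) * (m + 1) + (m - 1) = m * s + m * (m + 2)"
        using assms 2 by (cases m) (simp_all add: algebra_simps)
      then have "((m + 1) * (m + 1) + (m - 1)) mod (m * (m + 2)) = m * s"
        using s(2) by (metis mod_add_self2 mod_less)
      then show ?thesis
        by blast
    next
      case 3
      then obtain c where "m = q + c"
        by (metis le_iff_add)
      then have "(m + 1) * q + (m - q) = m * s"
        using 3 by (simp add: algebra_simps)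
      then have "((m + 1) * q + (m - q)) mod (m * (m + 2)) = m * s"
        using s(2) by simp
      then show ?thesis
        using 3 by (intro exI[of _ q] exI[of _ "m - q"]) auto
    qed
  qed
  then show thesis
    using that s by (metis of_nat_mod)
qed

text \<open>Here \<open>a j\<close> and \<open>b j\<close> count the fixed ones left and right of
  star \<open>j\<close>, and \<open>V\<close> consists of the stars that are one at the missing
  vertex. The condition \<open>Y \<noteq> V - {j}\<close> says that neither end of the edge over
  \<open>Y\<close> in direction \<open>j\<close> is that vertex.\<close>

lemma punctured_star_color:
  fixes a b :: "nat \<Rightarrow> nat"
  assumes m: "m \<ge> 1"
    and ab: "\<forall>j\<le>2 * m. a j + b j = T"
    and \<alpha>: "\<alpha> < m * (m + 2)"
  obtains j Y where "j \<le> 2 * m" "Y \<subseteq> {..2 * m}" "j \<notin> Y" "Y \<noteq> V - {j}"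
    "((m + 1) * (a j + card {y \<in> Y. y < j}) + (b j + card {y \<in> Y. j < y})) mod (m * (m + 2)) = \<alpha>"
proof -
  let ?M = "m * (m + 2)"
  note result = that
  have star: thesis
    if "j \<le> 2 * m" "A \<subseteq> {..<j}" "B \<subseteq> {j<..2 * m}"
      "A \<noteq> V \<inter> {..<j} \<or> B \<noteq> V \<inter> {j<..2 * m}"
      "((m + 1) * (a j + card A) + (b j + card B)) mod ?M = \<alpha>" for j A B
  proof (rule result[of j "A \<union> B"])
    have parts: "{y \<in> A \<union> B. y < j} = A" "{y \<in> A \<union> B. j < y} = B"
      using that(2,3) by (auto dest: subsetD)
    then show "((m + 1) * (a j + card {y \<in> A \<union> B. y < j}) + (b j + card {y \<in> A \<union> B. j < y})) mod ?M = \<alpha>"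
      using that(5) by simp
    have "A = V \<inter> {..<j} \<and> B = V \<inter> {j<..2 * m}" if eq: "A \<union> B = V - {j}"
    proof -
      have "A = {y \<in> V - {j}. y < j}" "B = {y \<in> V - {j}. j < y}"
        using parts unfolding eq by simp_all
      moreover have "B = B \<inter> {j<..2 * m}"
        using \<open>B \<subseteq> {j<..2 * m}\<close> by blast
      moreover have "{y \<in> V - {j}. y < j} = V \<inter> {..<j}"
        "{y \<in> V - {j}. j < y} \<inter> {j<..2 * m} = V \<inter> {j<..2 * m}"
        by auto
      ultimately show ?thesis
        by metis
    qed
    then show "A \<union> B \<noteq> V - {j}"
      using that(4) by blast
    show "j \<le> 2 * m" "A \<union> B \<subseteq> {..2 * m}" "j \<notin> A \<union> B"
      using that(1-3) by (auto dest: subsetD)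
  qed
  \<comment> \<open>Since \<open>a j + b j = T\<close>, the base color of star \<open>j\<close> is
    \<open>m * a j + T\<close>; base colors of different stars therefore differ by multiples of
    \<open>m\<close>.\<close>
  have shift: "(int ((m + 1) * a j + b j) + int m * t) mod int ?M =
      (int ((m + 1) * a m + b m) + int m * (t + (int (a j) - int (a m)))) mod int ?M"
    if "j \<le> 2 * m" for j t
  proof -
    have b: "int (b j) = int (a m) + int (b m) - int (a j)"
      using ab[rule_format, OF that] ab[rule_format, of m] by simp
    have "int ((m + 1) * a j + b j) + int m * t =
        int ((m + 1) * a m + b m) + int m * (t + (int (a j) - int (a m)))"
      by (simp add: b algebra_simps)
    then show ?thesis
      by simp
  qed
  have box: "((m + 1) * (a j + l) + (b j + r)) mod ?M = \<alpha>"
    if "j \<le> 2 * m" "(int ((m + 1) * a m + b m) + int m * t0) mod int ?M = int \<alpha>"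
      "int ((m + 1) * l + r) mod int ?M = (int m * (t0 - (int (a j) - int (a m)))) mod int ?M"
    for j l r t0
  proof -
    have "int (((m + 1) * (a j + l) + (b j + r)) mod ?M) =
        (int ((m + 1) * a j + b j) + int ((m + 1) * l + r)) mod int ?M"
      by (simp add: of_nat_mod algebra_simps)
    also have "\<dots> = (int ((m + 1) * a j + b j) + int m * (t0 - (int (a j) - int (a m)))) mod int ?M"
      using that(3) by (metis mod_add_right_eq)
    also have "\<dots> = int \<alpha>"
      unfolding shift[OF that(1)] using that(2) by simp
    finally show ?thesis
      by simp
  qed
  \<comment> \<open>The star \<open>m - 1\<close> has the stars \<open>m\<close> to
    \<open>2 * m\<close> on its right. If the missing vertex is not constant on them,
    \<open>B\<close> can avoid it whatever size \<open>r\<close> is required.\<close>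
  have left_star: thesis
    if t0: "(int ((m + 1) * a m + b m) + int m * t0) mod int ?M = int \<alpha>"
      and V: "V \<inter> {m..2 * m} \<noteq> {}" "V \<inter> {m..2 * m} \<noteq> {m..2 * m}" for t0
  proof -
    obtain l r where lr: "l \<le> m - 1" "r \<le> m + 1"
      "int ((m + 1) * l + r) mod int ?M = (int m * (t0 - (int (a (m - 1)) - int (a m)))) mod int ?M"
      using residue_in_tall_box[OF m] by blast
    have eq: "{m - 1<..2 * m} = {m..2 * m}"
      using m by auto
    obtain B where "B \<subseteq> {m..2 * m}" "card B = r" "B \<noteq> V \<inter> {m..2 * m}"
      by (rule obtain_subset_neq[of "{m..2 * m}" r "V \<inter> {m..2 * m}"]) (use V lr in simp_all)
    moreover obtain A where "A \<subseteq> {..<m - 1}" "card A = l"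
      using obtain_subset_with_card_n[of l "{..<m - 1}"] lr by auto
    ultimately show thesis
      using star[of "m - 1" A B] box[OF _ t0 lr(3)] eq by auto
  qed
  have right_star: thesis
    if t0: "(int ((m + 1) * a m + b m) + int m * t0) mod int ?M = int \<alpha>"
      and V: "V \<inter> {..m} \<noteq> {}" "V \<inter> {..m} \<noteq> {..m}" for t0
  proof -
    obtain l r where lr: "l \<le> m + 1" "r \<le> m - 1"
      "int ((m + 1) * l + r) mod int ?M = (int m * (t0 - (int (a (m + 1)) - int (a m)))) mod int ?M"
      using residue_in_wide_box[OF m] by blast
    have eq: "{..<m + 1} = {..m}"
      by auto
    obtain A where "A \<subseteq> {..m}" "card A = l" "A \<noteq> V \<inter> {..m}"
      by (rule obtain_subset_neq[of "{..m}" l "V \<inter> {..m}"]) (use V lr in simp_all)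
    moreover obtain B where "B \<subseteq> {m + 1<..2 * m}" "card B = r"
      using obtain_subset_with_card_n[of r "{m + 1<..2 * m}"] lr m by auto
    ultimately show thesis
      using star[of "m + 1" A B] box[OF _ t0 lr(3)] eq m by auto
  qed
  \<comment> \<open>\<open>\<beta>\<close> is the part of the color left to the free stars. As
    \<open>m * (m + 2) = (m + 1) * (m + 1) - 1\<close>, its digits in base \<open>m + 1\<close> are
    at most \<open>m\<close>, the number of stars on either side of the middle one, and not both
    equal to \<open>m\<close>.\<close>
  define \<beta> where "\<beta> = nat ((int \<alpha> - int ((m + 1) * a m + b m)) mod int ?M)"
  have M0: "int ?M > 0"
    using m by (simp del: of_nat_mult)
  have \<beta>_int: "int \<beta> = (int \<alpha> - int ((m + 1) * a m + b m)) mod int ?M"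
    using M0 by (simp add: \<beta>_def)
  then have \<beta>_lt: "\<beta> < ?M"
    using pos_mod_bound[OF M0, of "int \<alpha> - int ((m + 1) * a m + b m)"] by linarith
  define l r where "l = \<beta> div (m + 1)" and "r = \<beta> mod (m + 1)"
  have \<beta>: "\<beta> = (m + 1) * l + r"
    by (simp only: l_def r_def mult_div_mod_eq)
  have r: "r \<le> m"
    using mod_less_divisor[of "m + 1" \<beta>] by (simp add: r_def)
  have "\<beta> < (m + 1) * (m + 1)"
    using \<beta>_lt by (simp add: algebra_simps)
  then have l: "l \<le> m"
    unfolding l_def using less_mult_imp_div_less[of \<beta> "m + 1" "m + 1"] by simp
  have \<alpha>_int: "(int ((m + 1) * a m + b m) + int ((m + 1) * l + r)) mod int ?M = int \<alpha>"
    unfolding \<beta>[symmetric] \<beta>_int mod_add_right_eq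
    using \<alpha> by (metis add.commute diff_add_cancel mod_less of_nat_mod)
  have middle: "((m + 1) * (a m + l) + (b m + r)) mod ?M = \<alpha>"
  proof -
    have "int (((m + 1) * (a m + l) + (b m + r)) mod ?M) =
        (int ((m + 1) * a m + b m) + int ((m + 1) * l + r)) mod int ?M"
      by (simp add: of_nat_mod algebra_simps)
    then show ?thesis
      using \<alpha>_int by simp
  qed
  have cards: "card {..<m} = m" "card {m<..2 * m} = m"
    by auto
  obtain A0 where A0: "A0 \<subseteq> {..<m}" "card A0 = l"
    using obtain_subset_with_card_n[of l "{..<m}"] l by auto
  obtain B0 where B0: "B0 \<subseteq> {m<..2 * m}" "card B0 = r"
    using obtain_subset_with_card_n[of r "{m<..2 * m}"] r cards by metis
  let ?VL = "V \<inter> {..<m}" and ?VR = "V \<inter> {m<..2 * m}"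
  \<comment> \<open>The middle star fails only if the missing vertex is constant on each half and
    both digits are the matching extreme counts, so that neither set can be exchanged.\<close>
  show thesis
  proof (cases "(?VL = {} \<and> l = 0 \<or> ?VL = {..<m} \<and> l = m) \<and> (?VR = {} \<and> r = 0 \<or> ?VR = {m<..2 * m} \<and> r = m)")
    case False
    then consider "?VL \<noteq> {} \<or> l \<noteq> 0" "?VL \<noteq> {..<m} \<or> l \<noteq> card {..<m}"
      | "?VR \<noteq> {} \<or> r \<noteq> 0" "?VR \<noteq> {m<..2 * m} \<or> r \<noteq> card {m<..2 * m}"
      using cards by metis
    then show thesis
    proof cases
      case 1
      obtain A where "A \<subseteq> {..<m}" "card A = l" "A \<noteq> ?VL"
        using obtain_subset_neq[OF _ _ 1] l by auto
      then show thesis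
        using star[of m A B0] B0 middle by auto
    next
      case 2
      obtain B where "B \<subseteq> {m<..2 * m}" "card B = r" "B \<noteq> ?VR"
        using obtain_subset_neq[OF _ _ 2] r by auto
      then show thesis
        using star[of m A0 B] A0 middle by auto
    qed
  next
    case True
    then consider "?VL = {}" "?VR = {}" "l = 0" "r = 0" | "?VL = {..<m}" "?VR = {m<..2 * m}" "l = m" "r = m"
      | "?VL = {}" "?VR = {m<..2 * m}" "l = 0" "r = m" | "?VL = {..<m}" "?VR = {}" "l = m" "r = 0"
      by blast
    then show thesis
    proof cases
      case 1
      \<comment> \<open>The corner \<open>(m, m)\<close> has the same color as
        \<open>(0, 0)\<close>, because \<open>(m + 1) * m + m\<close> is the modulus.\<close>
      have "((m + 1) * (a m + m) + (b m + m)) mod ?M = ((m + 1) * a m + b m + ?M) mod ?M"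
        by (simp add: algebra_simps)
      then have "((m + 1) * (a m + m) + (b m + m)) mod ?M = \<alpha>"
        using middle 1 by simp
      then show thesis
        using star[of m "{..<m}" "{m<..2 * m}"] 1 m by auto
    next
      case 2
      then show thesis
        using \<beta> \<beta>_lt by (simp add: algebra_simps)
    next
      case 3
      \<comment> \<open>Relative to the base color this corner contributes \<open>m\<close>, and the
        corner \<open>(m, 0)\<close> below contributes \<open>m * (m + 1)\<close>. Since
        \<open>V\<close> differs on the two halves, star \<open>m\<close> disagrees with one of
        them, which opens the neighbouring star on the other side.\<close>
      have t0: "(int ((m + 1) * a m + b m) + int m * 1) mod int ?M = int \<alpha>"
        using \<alpha>_int 3 by simp
      show thesis
      proof (cases "m \<in> V")
        case True
        have "m \<in> V \<inter> {..m}" "0 \<notin> V \<inter> {..m}"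
          using True 3(1) m by auto
        then show thesis
          using right_star[OF t0] by blast
      next
        case False
        have "2 * m \<in> V \<inter> {m<..2 * m}"
          unfolding 3(2) using m by simp
        then have "m \<notin> V \<inter> {m..2 * m}" "2 * m \<in> V \<inter> {m..2 * m}"
          using False by auto
        then show thesis
          using left_star[OF t0] by (metis atLeastAtMost_iff empty_iff le_add1 mult_2 order_refl)
      qed
    next
      case 4
      have t0: "(int ((m + 1) * a m + b m) + int m * int (m + 1)) mod int ?M = int \<alpha>"
        using \<alpha>_int 4 by (simp add: algebra_simps)
      show thesis
      proof (cases "m \<in> V")
        case True
        have "m \<in> V \<inter> {m..2 * m}" "2 * m \<notin> V \<inter> {m..2 * m}"
          using True 4(2) m by auto
        then show thesis
          using left_star[OF t0] by (metis atLeastAtMost_iff empty_iff le_add1 mult_2 order_refl)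
      next
        case False
        have "0 \<in> V \<inter> {..<m}"
          unfolding 4(1) using m by simp
        then have "m \<notin> V \<inter> {..m}" "0 \<in> V \<inter> {..m}"
          using False by auto
        then show thesis
          using right_star[OF t0] by (metis atMost_iff empty_iff order_refl)
      qed
    qed
  qed
qed

section \<open>From star colors to a coloring of the hypercube\<close>

lemma edge_coloring_exists:
  "\<exists>c. \<forall>i<n. \<forall>X. X \<subseteq> {..<n} \<longrightarrow> i \<notin> X \<longrightarrow> c (cube_edge n i X) = w i X"
proof (intro exI allI impI)
  define P where "P e p \<longleftrightarrow> fst p < n \<and> snd p \<subseteq> {..<n} \<and> fst p \<notin> snd p \<and> e = cube_edge n (fst p) (snd p)"
    for e p
  define c where "c e = (let p = (SOME p. P e p) in w (fst p) (snd p))" for e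
  fix i X assume iX: "i < n" "X \<subseteq> {..<n}" "i \<notin> X"
  have "P (cube_edge n i X) (i, X)"
    using iX by (simp add: P_def)
  moreover have "p = (i, X)" if "P (cube_edge n i X) p" for p
  proof -
    have "i = fst p \<and> X = snd p"
      using that cube_edge_inject[of X n i "snd p" "fst p"] iX unfolding P_def by blast
    then show ?thesis
      by auto
  qed
  ultimately have "(SOME p. P (cube_edge n i X) p) = (i, X)"
    by blast
  then show "c (cube_edge n i X) = w i X"
    unfolding c_def by simp
qed

lemma card_split_image:
  fixes h :: "'a \<Rightarrow> 'b"
  assumes "finite B" "finite Y" "inj_on h Y" "B \<inter> h ` Y = {}"
  shows "card {z \<in> B \<union> h ` Y. P z} = card {z \<in> B. P z} + card {y \<in> Y. P (h y)}"
proof -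
  have "{z \<in> B \<union> h ` Y. P z} = {z \<in> B. P z} \<union> h ` {y \<in> Y. P (h y)}"
    by auto
  moreover have "card (h ` {y \<in> Y. P (h y)}) = card {y \<in> Y. P (h y)}"
    by (rule card_image) (rule inj_on_subset[OF assms(3)], auto)
  moreover have "{z \<in> B. P z} \<inter> h ` {y \<in> Y. P (h y)} = {}"
    using assms(4) by auto
  ultimately show ?thesis
    using assms(1,2) by (simp add: card_Un_disjoint)
qed

text \<open>An embedding of \<open>G\<close> restricts to the punctured cube inside
  \<open>G\<close>, and by rigidity the image of that is a subcube less one vertex, to which the
  star argument applies.\<close>

lemma polychromatic_punctured:
  fixes G :: "bool list graph"
  assumes m: "m \<ge> 1" and v: "length v = 2 * m + 1"
    and verts: "verts (hypercube (2 * m + 1)) - {v} \<subseteq> verts G"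
    and edges: "{e \<in> edges (hypercube (2 * m + 1)). v \<notin> e} \<subseteq> edges G"
  shows "polychromatic G (m * (m + 2))"
  unfolding polychromatic_def
proof (intro allI impI)
  fix n :: nat
  let ?M = "m * (m + 2)" and ?d = "2 * m + 1"
  obtain c where c: "\<And>i X. i < n \<Longrightarrow> X \<subseteq> {..<n} \<Longrightarrow> i \<notin> X \<Longrightarrow>
      c (cube_edge n i X) = ((m + 1) * card {x \<in> X. x < i} + card {x \<in> X. i < x}) mod ?M"
    using edge_coloring_exists[of n "\<lambda>i X. ((m + 1) * card {x \<in> X. x < i} + card {x \<in> X. i < x}) mod ?M"]
    by blast
  have "c e < ?M" if e: "e \<in> edges (hypercube n)" for e
  proof -
    obtain i X where iX: "i < n" "X \<subseteq> {..<n}" "i \<notin> X" "e = cube_edge n i X"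
      using edges_hypercubeE[OF e] .
    then show ?thesis
      using m c[OF iX(1-3)] by simp
  qed
  moreover have "\<exists>e\<in>edges H. c e = \<alpha>" if H: "embedding G n H" and \<alpha>: "\<alpha> < ?M" for H \<alpha>
  proof -
    have H_sub: "verts H \<subseteq> {x. length x = n}" "edges H \<subseteq> edges (hypercube n)"
      using H unfolding embedding_def subgraph_def by (auto simp: hypercube_def)
    obtain f where f: "bij_betw f (verts G) (verts H)"
      and f_edge: "\<And>x y. x \<in> verts G \<Longrightarrow> y \<in> verts G \<Longrightarrow>
        {x, y} \<in> edges G \<longleftrightarrow> {f x, f y} \<in> edges H"
      using H unfolding embedding_def isomorphic_def by blast
    have V: "{x. length x = ?d} - {v} \<subseteq> verts G"
      using verts by (simp add: hypercube_def)
    have hom: "f ` e \<in> edges H" if e: "e \<in> edges (hypercube ?d)" "v \<notin> e" for e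
    proof -
      obtain x y where xy: "e = {x, y}" "length x = ?d" "length y = ?d"
        using e unfolding hypercube_def by auto
      then have "x \<in> verts G" "y \<in> verts G"
        using V e by auto
      then show ?thesis
        using f_edge[of x y] edges e xy by auto
    qed
    obtain D W where D: "D \<subseteq> {..<n}" "card D = ?d" and W: "W \<subseteq> {..<n}"
      and DW: "\<And>Z i. Z \<subseteq> {..<n} \<Longrightarrow> i \<in> D \<Longrightarrow> i \<notin> Z \<Longrightarrow> Z - D = W - D \<Longrightarrow> Z \<noteq> W \<Longrightarrow>
        insert i Z \<noteq> W \<Longrightarrow> cube_edge n i Z \<in> edges H"
    proof (rule punctured_cube_rigid[of ?d v f n "edges H"])
      show "inj_on f ({x. length x = ?d} - {v})"
        using f V by (meson bij_betw_imp_inj_on inj_on_subset)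
      show "length (f x) = n" if "length x = ?d" "x \<noteq> v" for x
        using that V H_sub(1) bij_betwE[OF f] by blast
    qed (use m v hom H_sub in auto)
    have fin: "finite D" "finite W"
      using D W finite_subset by blast+
    \<comment> \<open>Listing the stars in increasing order makes counts left and right of a star
      the same for coordinates and for star indices.\<close>
    obtain h where h: "bij_betw h {..<?d} D" and h_mono: "strict_mono_on {..<?d} h"
      using ex_bij_betw_strict_mono_card[OF fin(1)] D(2) by metis
    have h_inj: "inj_on h {..<?d}" and h_D: "\<And>t. t < ?d \<Longrightarrow> h t \<in> D"
      using h by (auto simp: bij_betw_def)
    have h_less: "h s < h t \<longleftrightarrow> s < t" if "s < ?d" "t < ?d" for s t
      using strict_mono_on_less[OF h_mono] that by simp
    define B where "B = W - D"
    have B: "finite B" "B \<subseteq> {..<n}" "B \<inter> D = {}"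
      using fin W by (auto simp: B_def)
    define a b where "a j = card {x \<in> B. x < h j}" and "b j = card {x \<in> B. h j < x}" for j
    have ab: "\<forall>j\<le>2 * m. a j + b j = card B"
    proof (intro allI impI)
      fix j assume "j \<le> 2 * m"
      have "h j \<notin> B"
        using h_D[of j] \<open>j \<le> 2 * m\<close> B by auto
      then have "B = {x \<in> B. x < h j} \<union> {x \<in> B. h j < x}"
        using nat_neq_iff by auto
      then have "card B = card ({x \<in> B. x < h j} \<union> {x \<in> B. h j < x})"
        by simp
      also have "\<dots> = a j + b j"
        unfolding a_def b_def using B by (intro card_Un_disjoint) auto
      finally show "a j + b j = card B"
        by simp
    qed
    define V where "V = {t. t < ?d \<and> h t \<in> W}"
    obtain j Y where jY: "j \<le> 2 * m" "Y \<subseteq> {..2 * m}" "j \<notin> Y" "Y \<noteq> V - {j}"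
      and col: "((m + 1) * (a j + card {y \<in> Y. y < j}) + (b j + card {y \<in> Y. j < y})) mod ?M = \<alpha>"
      by (rule punctured_star_color[where V = V, OF m ab \<alpha>]) (rule that)
    have "Y \<subseteq> {..<?d}"
      using jY(2) by auto
    then have Y: "Y \<subseteq> {..<?d}" "finite Y" "inj_on h Y"
      using inj_on_subset[OF h_inj] finite_subset by blast+
    define Z where "Z = B \<union> h ` Y"
    have Z_D: "h t \<in> Z \<longleftrightarrow> t \<in> Y" if "t < ?d" for t
      using that Y h_inj h_D[OF that] B(3) unfolding Z_def
      by (auto simp: inj_on_def)
    have sub: "Z \<subseteq> {..<n}"
    proof -
      have "h ` Y \<subseteq> D"
        using Y(1) h_D by auto
      then show ?thesis
        using B(2) D(1) unfolding Z_def by simp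
    qed
    have "Y = V" if "Z = W"
    proof -
      have "t \<in> Y \<longleftrightarrow> t \<in> V" for t
        using Z_D[of t] Y(1) that by (auto simp: V_def)
      then show ?thesis
        by blast
    qed
    then have ne1: "Z \<noteq> W"
      using jY by auto
    have "Y = V - {j}" if "insert (h j) Z = W"
    proof -
      have "t \<in> Y \<longleftrightarrow> t \<in> V - {j}" for t
        using Z_D[of t] Y(1) jY(1,3) that h_inj by (auto simp: V_def inj_on_def)
      then show ?thesis
        by blast
    qed
    then have ne2: "insert (h j) Z \<noteq> W"
      using jY by auto
    have "Z - D = W - D"
      using B Y h_D unfolding Z_def B_def by auto
    then have edge: "cube_edge n (h j) Z \<in> edges H"
      using DW[of Z "h j"] sub h_D[of j] jY Z_D[of j] ne1 ne2 by auto
    have disj: "B \<inter> h ` Y = {}"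
      using B h_D Y by auto
    have "{y \<in> Y. h y < h j} = {y \<in> Y. y < j}" "{y \<in> Y. h j < h y} = {y \<in> Y. j < y}"
      using h_less Y jY by auto
    then have "card {z \<in> Z. z < h j} = a j + card {y \<in> Y. y < j}"
      "card {z \<in> Z. h j < z} = b j + card {y \<in> Y. j < y}"
      unfolding Z_def card_split_image[OF B(1) Y(2,3) disj] by (simp_all add: a_def b_def)
    then have "c (cube_edge n (h j) Z) = \<alpha>"
      using c[of "h j" Z] sub h_D[of j] D jY Z_D[of j] col by auto
    then show ?thesis
      using edge by blast
  qed
  ultimately show "\<exists>c. polychromatic_coloring G n ?M c"
    unfolding polychromatic_coloring_def by blast
qed

section \<open>Colorings of the grid\<close>

lemma bounded_mono_repeats:
  fixes f :: "nat \<Rightarrow> nat"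
  assumes "mono f" "\<And>q. f q \<le> n"
  obtains q where "q \<le> n" "f q = f (Suc q)"
proof (rule ccontr)
  assume "\<not> thesis"
  then have ne: "f q \<noteq> f (Suc q)" if "q \<le> n" for q
    using that \<open>\<And>q. q \<le> n \<Longrightarrow> f q = f (Suc q) \<Longrightarrow> thesis\<close> by blast
  have "q \<le> Suc n \<Longrightarrow> q \<le> f q" for q
  proof (induction q)
    case (Suc q)
    have "f q < f (Suc q)"
      using ne[of q] Suc.prems monoD[OF assms(1), of q "Suc q"] by simp
    then show ?case
      using Suc by simp
  qed simp
  then show False
    using assms(2)[of "Suc n"] by fastforce
qed

text \<open>
  For each \<open>i\<close>, chains \<open>a\<^sub>0 \<le> a\<^sub>1 \<le> \<dots>\<close> with \<open>A i t a\<^sub>t\<close> are built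
  from the left and from the right. As a position moves, the attainable lengths change only
  boundedly often, so some segment is crossed by no such change.
\<close>

lemma stable_segment:
  fixes A :: "nat \<Rightarrow> nat \<Rightarrow> nat \<Rightarrow> bool" and K d L :: nat
  defines "N \<equiv> (2 * (K * d) + 1) * L"
  assumes no_full: "\<And>i a. i < K \<Longrightarrow> mono_on {..<d} a \<Longrightarrow> \<forall>j<d. A i j (a j) \<and> a j < N \<Longrightarrow> False"
  obtains p where "p + L \<le> N"
    "\<And>i. i < K \<Longrightarrow> \<exists>j<d. (\<forall>a\<in>{p..<p + L}. \<not> A i j a) \<and>
      (\<exists>a. mono_on {..<j} a \<and> (\<forall>t<j. A i t (a t) \<and> a t < p))"
    "\<And>i. i < K \<Longrightarrow> \<exists>j<d. (\<forall>a\<in>{p..<p + L}. \<not> A i j a) \<and>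
      (\<exists>a. mono_on {j<..<d} a \<and> (\<forall>t\<in>{j<..<d}. A i t (a t) \<and> p + L \<le> a t \<and> a t < N))"
proof -
  define left where "left i j p \<longleftrightarrow> (\<exists>a. mono_on {..<j} a \<and> (\<forall>t<j. A i t (a t) \<and> a t < p))"
    for i j p
  define right where "right i j p \<longleftrightarrow>
      (\<exists>a. mono_on {j..<d} a \<and> (\<forall>t\<in>{j..<d}. A i t (a t) \<and> p \<le> a t \<and> a t < N))" for i j p
  have left_mono: "left i j q" if "left i j p" "p \<le> q" for i j p q
    using that unfolding left_def by (meson order_less_le_trans)
  have right_mono: "right i j p" if "right i j q" "p \<le> q" for i j p q
    using that unfolding right_def by (meson order_trans)
  have left_0: "left i 0 p" for i p
    by (simp add: left_def mono_on_def)
  have right_d: "right i d p" for i p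
    by (simp add: right_def mono_on_def)
  have not_left: "\<not> left i d p" if "i < K" "p \<le> N" for i p
  proof
    assume "left i d p"
    then have "left i d N"
      using left_mono that by blast
    then show False
      using no_full[OF that(1)] unfolding left_def by blast
  qed
  have not_right: "\<not> right i 0 p" if "i < K" for i p
  proof
    assume "right i 0 p"
    then obtain a where "mono_on {0..<d} a" "\<forall>t\<in>{0..<d}. A i t (a t) \<and> p \<le> a t \<and> a t < N"
      unfolding right_def by blast
    then show False
      using no_full[OF that, of a] by (simp add: atLeast0LessThan)
  qed
  let ?F = "{..<K} \<times> {..<d}"
  \<comment> \<open>The negation in \<open>rs\<close> makes both sets grow with \<open>p\<close>.
    Their sizes add up to at most \<open>2 * (K * d)\<close>, so one of the
    \<open>2 * (K * d) + 1\<close> blocks of length \<open>L\<close> changes neither set.\<close>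
  define ls where "ls p = {(i, j) \<in> ?F. left i (Suc j) p}" for p
  define rs where "rs p = {(i, j) \<in> ?F. \<not> right i j p}" for p
  have sub: "ls p \<subseteq> ?F" "rs p \<subseteq> ?F" for p
    by (auto simp: ls_def rs_def)
  have fin: "finite (ls p)" "finite (rs p)" for p
    using sub[of p] finite_subset[of _ ?F] by auto
  have ls_mono: "ls p \<subseteq> ls q" if "p \<le> q" for p q
    using left_mono that by (auto simp: ls_def)
  have rs_mono: "rs p \<subseteq> rs q" if "p \<le> q" for p q
    using right_mono that by (auto simp: rs_def)
  define f where "f q = card (ls (q * L)) + card (rs (q * L))" for q
  have "mono f"
  proof (rule monoI)
    fix q q' :: nat assume "q \<le> q'"
    then show "f q \<le> f q'"
      unfolding f_def using ls_mono rs_mono fin by (intro add_mono card_mono) auto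
  qed
  moreover have "f q \<le> 2 * (K * d)" for q
    unfolding f_def using card_mono[OF _ sub(1), of "q * L"] card_mono[OF _ sub(2), of "q * L"] by simp
  ultimately obtain q where q: "q \<le> 2 * (K * d)" "f q = f (Suc q)"
    using bounded_mono_repeats[of f "2 * (K * d)"] by blast
  define p where "p = q * L"
  have pL: "Suc q * L = p + L"
    by (simp add: p_def)
  have "card (ls p) \<le> card (ls (p + L))"
    by (intro card_mono fin ls_mono) simp
  moreover have "card (rs p) \<le> card (rs (p + L))"
    by (intro card_mono fin rs_mono) simp
  ultimately have "card (ls p) = card (ls (p + L))" "card (rs p) = card (rs (p + L))"
    using q(2) unfolding f_def pL p_def[symmetric] by linarith+
  then have eq: "ls p = ls (p + L)" "rs p = rs (p + L)"
    using card_subset_eq[OF fin(1) ls_mono[of p "p + L"]] card_subset_eq[OF fin(2) rs_mono[of p "p + L"]]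
    by auto
  have pN: "p + L \<le> N"
    unfolding pL[symmetric] N_def using q(1) by (intro mult_le_mono1) simp
  show thesis
  proof (rule that[OF pN])
    fix i assume i: "i < K"
    have d: "d > 0"
      using left_0[of i 0] not_left[OF i, of 0] by (cases d) auto
    show "\<exists>j<d. (\<forall>a\<in>{p..<p + L}. \<not> A i j a) \<and> (\<exists>a. mono_on {..<j} a \<and> (\<forall>t<j. A i t (a t) \<and> a t < p))"
    proof -
      \<comment> \<open>The first \<open>j\<close> shapes fit before \<open>p\<close>, but not one
        more. A position for shape \<open>j\<close> inside the block would extend the chain and
        enlarge \<open>ls\<close>.\<close>
      define j where "j = (LEAST j. \<not> left i (Suc j) p)"
      have ex: "\<not> left i (Suc (d - 1)) p"
        using not_left[OF i] d pN by simp
      have j: "\<not> left i (Suc j) p" "j < d"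
        using LeastI[of "\<lambda>j. \<not> left i (Suc j) p", OF ex] Least_le[of "\<lambda>j. \<not> left i (Suc j) p", OF ex] d
        unfolding j_def by auto
      have "left i j p"
      proof (cases j)
        case (Suc j')
        then show ?thesis
          using not_less_Least[of j' "\<lambda>j. \<not> left i (Suc j) p"] unfolding j_def by simp
      qed (simp add: left_0)
      then obtain a where a: "mono_on {..<j} a" "\<forall>t<j. A i t (a t) \<and> a t < p"
        unfolding left_def by blast
      have "\<not> A i j b" if b: "b \<in> {p..<p + L}" for b
      proof
        assume "A i j b"
        have "mono_on {..<Suc j} (a(j := b))"
        proof (rule mono_onI)
          fix r s assume "r \<in> {..<Suc j}" "s \<in> {..<Suc j}" "r \<le> s"
          then show "(a(j := b)) r \<le> (a(j := b)) s"
            using a b mono_onD[OF a(1), of r s] by (auto simp: less_Suc_eq intro: order_trans less_imp_le)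
        qed
        moreover have "\<forall>t<Suc j. A i t ((a(j := b)) t) \<and> (a(j := b)) t < p + L"
          using a b \<open>A i j b\<close> by (auto simp: less_Suc_eq)
        ultimately have "left i (Suc j) (p + L)"
          unfolding left_def by blast
        then have "(i, j) \<in> ls (p + L)"
          using i j by (simp add: ls_def)
        then show False
          using eq j by (auto simp: ls_def)
      qed
      then show ?thesis
        using a j by blast
    qed
    show "\<exists>j<d. (\<forall>a\<in>{p..<p + L}. \<not> A i j a) \<and>
      (\<exists>a. mono_on {j<..<d} a \<and> (\<forall>t\<in>{j<..<d}. A i t (a t) \<and> p + L \<le> a t \<and> a t < N))"
    proof -
      let ?S = "{j. j < d \<and> \<not> right i j (p + L)}"
      \<comment> \<open>Symmetrically, the shapes after \<open>j\<close> fit beyond the block, and a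
        position for shape \<open>j\<close> inside it would make \<open>right i j p\<close> true
        although \<open>right i j (p + L)\<close> is false.\<close>
      define j where "j = Max ?S"
      have S: "finite ?S" "0 \<in> ?S"
        using not_right[OF i] d by auto
      then have j: "j < d" "\<not> right i j (p + L)"
        using Max_in[of ?S] unfolding j_def by blast+
      have "right i (Suc j) (p + L)"
      proof (cases "Suc j = d")
        case True
        then show ?thesis
          using right_d by metis
      next
        case False
        then show ?thesis
          using Max_ge[OF S(1), of "Suc j"] j unfolding j_def by (metis (mono_tags, lifting) Suc_lessI mem_Collect_eq not_less_eq_eq order_refl)
      qed
      moreover have "{Suc j..<d} = {j<..<d}"
        by auto
      ultimately obtain a where a: "mono_on {j<..<d} a"
        "\<forall>t\<in>{j<..<d}. A i t (a t) \<and> p + L \<le> a t \<and> a t < N"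
        unfolding right_def by metis
      have "\<not> A i j b" if b: "b \<in> {p..<p + L}" for b
      proof
        assume "A i j b"
        have "mono_on {j..<d} (a(j := b))"
        proof (rule mono_onI)
          fix r s assume rs: "r \<in> {j..<d}" "s \<in> {j..<d}" "r \<le> s"
          consider "r = j" "s = j" | "r = j" "s \<in> {j<..<d}" | "r \<in> {j<..<d}" "s \<in> {j<..<d}"
            using rs by fastforce
          then show "(a(j := b)) r \<le> (a(j := b)) s"
          proof cases
            case 2
            then have "p + L \<le> a s"
              using a(2) by blast
            then show ?thesis
              using 2 b by simp
          next
            case 3
            then show ?thesis
              using mono_onD[OF a(1), of r s] rs by simp
          qed simp
        qed
        moreover have "\<forall>t\<in>{j..<d}. A i t ((a(j := b)) t) \<and> p \<le> (a(j := b)) t \<and> (a(j := b)) t < N"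
        proof
          fix t assume t: "t \<in> {j..<d}"
          show "A i t ((a(j := b)) t) \<and> p \<le> (a(j := b)) t \<and> (a(j := b)) t < N"
          proof (cases "t = j")
            case True
            then show ?thesis
              using b pN \<open>A i j b\<close> by simp
          next
            case False
            then have "A i t (a t) \<and> p + L \<le> a t \<and> a t < N"
              using a(2) t by simp
            then show ?thesis
              using False by simp
          qed
        qed
        ultimately have "right i j p"
          unfolding right_def by blast
        then have "(i, j) \<notin> rs p"
          by (simp add: rs_def)
        moreover have "(i, j) \<in> rs (p + L)"
          using i j by (simp add: rs_def)
        ultimately show False
          using eq by simp
      qed
      then show ?thesis
        using a j by blast
    qed
  qed
qed

section \<open>Cells of rectangles along an antidiagonal strip\<close>

text \<open>
  On the strip above the antidiagonal \<open>l + r = T\<close> the grid point \<open>(l, r)\<close> is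
  addressed by \<open>(l, s)\<close> with \<open>s = l + r - T\<close>. Then \<open>diag m J s\<close> are the horizontal
  positions of the cells with offset \<open>s\<close> in a rectangle of size \<open>(J + 1) \<times> (2 m + 1 - J)\<close>
  whose corner lies on the antidiagonal.
\<close>

definition diag :: "nat \<Rightarrow> nat \<Rightarrow> nat \<Rightarrow> nat set" where
  "diag m J s = {x. x \<le> J \<and> x \<le> s \<and> s - x \<le> 2 * m - J}"

lemma diag_eq: "diag m J s = {s - (2 * m - J)..min J s}"
  by (auto simp: diag_def)

lemma finite_diag [simp]: "finite (diag m J s)"
  by (simp add: diag_eq)

lemma card_diag: "card (diag m J s) = Suc (min J s) - (s - (2 * m - J))"
  by (simp add: diag_eq)

text \<open>The diagonal has one cell more than the minimum of \<open>J\<close>,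
  \<open>2 * m - J\<close>, \<open>s\<close> and \<open>2 * m - s\<close>, and the first two have
  the largest minimum for the square. At \<open>s = m\<close> only the square attains the maximum,
  hence the strict version that follows.\<close>

lemma card_diag_le:
  assumes "J \<le> 2 * m" "s \<le> 2 * m"
  shows "card (diag m J s) \<le> card (diag m m s)"
  unfolding card_diag using assms by (auto simp: min_def)

lemma card_diag_less:
  assumes "J \<le> 2 * m" "J \<noteq> m"
  shows "card (diag m J m) < card (diag m m m)"
  unfolding card_diag using assms by (auto simp: min_def)

lemma sum_card_diag: "(\<Sum>s\<le>2 * m. card (diag m m s)) = (m + 1)\<^sup>2"
proof -
  have "(\<Sum>s\<le>2 * m. card (diag m m s)) = card (SIGMA s:{..2 * m}. diag m m s)"
    by simp
  also have "\<dots> = card ({..m} \<times> {..m})"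
  proof (rule bij_betw_same_card)
    show "bij_betw (\<lambda>(s, x). (x, s - x)) (SIGMA s:{..2 * m}. diag m m s) ({..m} \<times> {..m})"
      by (rule bij_betwI[where g = "\<lambda>(x, y). (x + y, x)"]) (auto simp: diag_def)
  qed
  also have "\<dots> = (m + 1)\<^sup>2"
    by (simp add: power2_eq_square)
  finally show ?thesis .
qed

text \<open>
  Double counting of the pairs of a base point and a cell whose color \<open>i\<close> is counted in the
  rectangle of shape \<open>J i\<close>. Each cell is counted at most as often as with squares throughout,
  and strictly less often on the diagonal \<open>s = m\<close> of the square if \<open>J i \<noteq> m\<close>, so there is
  room for only a bounded number of repetitions.
\<close>

lemma unique_corner_color:
  fixes \<chi> :: "nat \<Rightarrow> nat \<Rightarrow> nat" and J :: "nat \<Rightarrow> nat" and m p L :: nat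
  defines "K \<equiv> (m + 1)\<^sup>2"
  assumes \<chi>: "\<And>l s. \<chi> l s < K"
    and J: "\<And>i. i < K \<Longrightarrow> J i \<le> 2 * m"
    and hits: "\<And>i a. i < K \<Longrightarrow> a \<in> {p..<p + L} \<Longrightarrow> \<exists>x\<le>J i. \<exists>y\<le>2 * m - J i. \<chi> (a + x) (x + y) = i"
    and L: "L > 2 * m * K"
  obtains a where "a \<in> {p..<p + L}" "J (\<chi> a m) = m"
    "\<And>x y. x \<le> m \<Longrightarrow> y \<le> m \<Longrightarrow> \<chi> (a + x) (x + y) = \<chi> a m \<Longrightarrow> x = 0 \<and> y = m"
proof (rule ccontr)
  assume contra: "\<not> thesis"
  let ?B = "{p..<p + L}" and ?C = "{p..<p + L + 2 * m}"
  have bad: "\<exists>x\<le>m. \<exists>y\<le>m. \<chi> (a + x) (x + y) = \<chi> a m \<and> \<not> (x = 0 \<and> y = m)"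
    if "a \<in> ?B" "J (\<chi> a m) = m" for a
    using contra that \<open>\<And>a. a \<in> ?B \<Longrightarrow> J (\<chi> a m) = m \<Longrightarrow>
      (\<And>x y. x \<le> m \<Longrightarrow> y \<le> m \<Longrightarrow> \<chi> (a + x) (x + y) = \<chi> a m \<Longrightarrow> x = 0 \<and> y = m) \<Longrightarrow> thesis\<close>
    by blast
  \<comment> \<open>Relative to the base point \<open>a\<close>, these are the cells lying in the
    rectangle whose shape is assigned to their own color. Each color has such a cell; if the color
    of the corner is assigned the square, \<open>bad\<close> supplies a second one.\<close>
  define P where "P a = {(x, s). s \<le> 2 * m \<and> x \<in> diag m (J (\<chi> (a + x) s)) s}" for a
  have P_sub: "P a \<subseteq> {..2 * m} \<times> {..2 * m}" for a
    by (auto simp: P_def diag_def)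
  have P_fin: "finite (P a)" for a
    using finite_subset[OF P_sub] by blast
  have cell: "(x, x + y) \<in> P a" if "x \<le> J i" "y \<le> 2 * m - J i" "\<chi> (a + x) (x + y) = i" "i < K" for a x y i
    using that J[OF that(4)] by (auto simp: P_def diag_def)
  have lower: "K + of_bool (J (\<chi> a m) = m) \<le> card (P a)" if a: "a \<in> ?B" for a
  proof -
    let ?g = "\<lambda>(x, s). \<chi> (a + x) s"
    have "{..<K} \<subseteq> ?g ` P a"
    proof
      fix i assume "i \<in> {..<K}"
      then obtain x y where "x \<le> J i" "y \<le> 2 * m - J i" "\<chi> (a + x) (x + y) = i"
        using hits[of i a] a by auto
      then show "i \<in> ?g ` P a"
        using cell[of x i y a] \<open>i \<in> {..<K}\<close> by (intro image_eqI[of _ _ "(x, x + y)"]) auto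
    qed
    moreover have "?g ` P a \<subseteq> {..<K}"
      using \<chi> by auto
    ultimately have "?g ` P a = {..<K}"
      by (rule subset_antisym[rotated])
    then have img: "card (?g ` P a) = K"
      by (metis card_lessThan)
    then have K_le: "K \<le> card (P a)"
      using card_image_le[OF P_fin, of ?g a] by simp
    show ?thesis
    proof (cases "J (\<chi> a m) = m")
      case True
      obtain x y where xy: "x \<le> m" "y \<le> m" "\<chi> (a + x) (x + y) = \<chi> a m" "\<not> (x = 0 \<and> y = m)"
        using bad[OF a True] by blast
      have "(x, x + y) \<in> P a" "(0, m) \<in> P a"
        using cell[of x "\<chi> a m" y a] cell[of 0 "\<chi> a m" m a] xy True \<chi> by auto
      moreover have "?g (x, x + y) = ?g (0, m)" "(x, x + y) \<noteq> (0, m)"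
        using xy by auto
      ultimately have "\<not> inj_on ?g (P a)"
        by (meson inj_onD)
      then have "card (P a) \<noteq> K"
        using eq_card_imp_inj_on[OF P_fin, of ?g a] img by auto
      then show ?thesis
        using K_le by auto
    next
      case False
      then show ?thesis
        using K_le by simp
    qed
  qed
  have upper: "(\<Sum>s\<le>2 * m. card (diag m (J (\<chi> l s)) s)) + of_bool (J (\<chi> l m) \<noteq> m) \<le> K" for l
  proof -
    have "(\<Sum>s\<le>2 * m. card (diag m (J (\<chi> l s)) s)) + of_bool (J (\<chi> l m) \<noteq> m) =
        (\<Sum>s\<le>2 * m. card (diag m (J (\<chi> l s)) s) + (if s = m then of_bool (J (\<chi> l m) \<noteq> m) else 0))"
      by (simp add: sum.distrib)
    also have "\<dots> \<le> (\<Sum>s\<le>2 * m. card (diag m m s))"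
    proof (rule sum_mono)
      fix s assume s: "s \<in> {..2 * m}"
      show "card (diag m (J (\<chi> l s)) s) + (if s = m then of_bool (J (\<chi> l m) \<noteq> m) else 0) \<le> card (diag m m s)"
        using card_diag_le[OF J[OF \<chi>], of s l s] card_diag_less[OF J[OF \<chi>], of l m] s by auto
    qed
    finally show ?thesis
      by (simp add: sum_card_diag K_def)
  qed
  \<comment> \<open>A base point with a cell is recorded by the absolute cell and the offset
    \<open>x\<close>; \<open>?C\<close> is longer than \<open>?B\<close> by \<open>2 * m\<close>
    because \<open>x \<le> 2 * m\<close>.\<close>
  have "card (SIGMA a:?B. P a) \<le> card (SIGMA q:?C \<times> {..2 * m}. diag m (J (\<chi> (fst q) (snd q))) (snd q))"
  proof (rule card_inj_on_le[where f = "\<lambda>(a, x, s). ((a + x, s), x)"])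
    show "inj_on (\<lambda>(a, x, s). ((a + x, s), x)) (SIGMA a:?B. P a)"
      by (auto simp: inj_on_def)
    show "(\<lambda>(a, x, s). ((a + x, s), x)) ` (SIGMA a:?B. P a) \<subseteq>
        (SIGMA q:?C \<times> {..2 * m}. diag m (J (\<chi> (fst q) (snd q))) (snd q))"
    proof
      fix z assume "z \<in> (\<lambda>(a, x, s). ((a + x, s), x)) ` (SIGMA a:?B. P a)"
      then obtain a x s where z: "z = ((a + x, s), x)" "a \<in> ?B" "(x, s) \<in> P a"
        by auto
      moreover have "x \<le> 2 * m"
        using z(3) P_sub by blast
      ultimately show "z \<in> (SIGMA q:?C \<times> {..2 * m}. diag m (J (\<chi> (fst q) (snd q))) (snd q))"
        by (auto simp: P_def)
    qed
  qed auto
  then have "(\<Sum>a\<in>?B. card (P a)) \<le> (\<Sum>q\<in>?C \<times> {..2 * m}. card (diag m (J (\<chi> (fst q) (snd q))) (snd q)))"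
    using P_fin by simp
  also have "\<dots> = (\<Sum>l\<in>?C. \<Sum>s\<le>2 * m. card (diag m (J (\<chi> l s)) s))"
    by (simp add: sum.cartesian_product case_prod_beta)
  finally have count: "(\<Sum>a\<in>?B. card (P a)) \<le> (\<Sum>l\<in>?C. \<Sum>s\<le>2 * m. card (diag m (J (\<chi> l s)) s))" .
  \<comment> \<open>Every base point yields one unit beyond \<open>K\<close>: in the lower bound if
    the color of the corner is assigned the square, in the upper bound otherwise. These
    \<open>L\<close> units exceed the boundary surplus \<open>2 * m * K\<close>.\<close>
  have "K * L + L = (\<Sum>a\<in>?B. K + (of_bool (J (\<chi> a m) = m) + of_bool (J (\<chi> a m) \<noteq> m)))"
  proof -
    have "of_bool (J (\<chi> a m) = m) + of_bool (J (\<chi> a m) \<noteq> m) = (1 :: nat)" for a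
      by simp
    then show ?thesis
      by simp
  qed
  also have "\<dots> = (\<Sum>a\<in>?B. K + of_bool (J (\<chi> a m) = m)) + (\<Sum>a\<in>?B. of_bool (J (\<chi> a m) \<noteq> m))"
    by (simp only: sum.distrib add.assoc)
  also have "\<dots> \<le> (\<Sum>a\<in>?B. card (P a)) + (\<Sum>l\<in>?C. of_bool (J (\<chi> l m) \<noteq> m))"
  proof (rule add_mono)
    show "(\<Sum>a\<in>?B. K + of_bool (J (\<chi> a m) = m)) \<le> (\<Sum>a\<in>?B. card (P a))"
      using lower by (rule sum_mono)
    show "(\<Sum>a\<in>?B. of_bool (J (\<chi> a m) \<noteq> m)) \<le> (\<Sum>l\<in>?C. of_bool (J (\<chi> l m) \<noteq> m) :: nat)"
      by (rule sum_mono2) auto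
  qed
  also have "\<dots> \<le> (\<Sum>l\<in>?C. (\<Sum>s\<le>2 * m. card (diag m (J (\<chi> l s)) s)) + of_bool (J (\<chi> l m) \<noteq> m))"
    using count by (simp add: sum.distrib)
  also have "\<dots> \<le> (\<Sum>l\<in>?C. K)"
    using upper by (rule sum_mono)
  also have "\<dots> = K * L + 2 * m * K"
    by (simp add: algebra_simps)
  finally show False
    using L by simp
qed

text \<open>A monotone \<open>a\<close> encodes a subcube with \<open>T\<close> fixed ones,
  \<open>a j\<close> of them left of star \<open>j\<close>; the edges in that direction realize the
  rectangle of shape \<open>j\<close> at \<open>(a j, T - a j)\<close>. Either some color has a
  sequence avoiding it entirely, or a stable segment provides one avoided up to a single
  corner.\<close>

lemma shape_sequence_missing_color:
  fixes m :: nat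
  obtains T where "\<And>\<chi> :: nat \<Rightarrow> nat \<Rightarrow> nat. (\<And>l r. \<chi> l r < (m + 1)\<^sup>2) \<Longrightarrow>
    \<exists>\<alpha><(m + 1)\<^sup>2. \<exists>a. mono_on {..2 * m} a \<and> (\<forall>j\<le>2 * m. a j \<le> T) \<and>
      (\<forall>j\<le>2 * m. \<forall>x\<le>j. \<forall>y\<le>2 * m - j. \<chi> (a j + x) (T - a j + y) = \<alpha> \<longrightarrow> j = m \<and> x = 0 \<and> y = m)"
proof
  define K where "K = (m + 1)\<^sup>2"
  define L where "L = 2 * m * K + 1"
  define T where "T = (2 * (K * (2 * m + 1)) + 1) * L"
  have less_d: "{..<2 * m + 1} = {..2 * m}" "\<And>j. j < 2 * m + 1 \<longleftrightarrow> j \<le> 2 * m"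
    by auto
  fix \<chi> :: "nat \<Rightarrow> nat \<Rightarrow> nat"
  assume "\<And>l r. \<chi> l r < (m + 1)\<^sup>2"
  then have \<chi>: "\<chi> l r < K" for l r
    by (simp add: K_def)
  define A where "A i j a \<longleftrightarrow> (\<forall>x\<le>j. \<forall>y\<le>2 * m - j. \<chi> (a + x) (T - a + y) \<noteq> i)" for i j a
  show "\<exists>\<alpha><(m + 1)\<^sup>2. \<exists>a. mono_on {..2 * m} a \<and> (\<forall>j\<le>2 * m. a j \<le> T) \<and>
      (\<forall>j\<le>2 * m. \<forall>x\<le>j. \<forall>y\<le>2 * m - j. \<chi> (a j + x) (T - a j + y) = \<alpha> \<longrightarrow> j = m \<and> x = 0 \<and> y = m)"
    (is ?goal)
  proof (cases "\<exists>i<K. \<exists>a. mono_on {..2 * m} a \<and> (\<forall>j\<le>2 * m. A i j (a j) \<and> a j < T)")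
    case True
    then obtain i a where i: "i < K" and a: "mono_on {..2 * m} a" "\<forall>j\<le>2 * m. A i j (a j) \<and> a j < T"
      by blast
    have "a j \<le> T" if "j \<le> 2 * m" for j
      using a(2) that by (simp add: less_imp_le)
    moreover have "\<chi> (a j + x) (T - a j + y) \<noteq> i" if "j \<le> 2 * m" "x \<le> j" "y \<le> 2 * m - j" for j x y
      using a(2) that unfolding A_def by blast
    ultimately show ?goal
      using i a(1) unfolding K_def by blast
  next
    case False
    have no_full: False if "i < K" "mono_on {..<2 * m + 1} a" "\<forall>j<2 * m + 1. A i j (a j) \<and> a j < T" for i a
      using False that unfolding less_d by blast
    obtain p where p: "p + L \<le> T"
      and left: "\<And>i. i < K \<Longrightarrow> \<exists>j<2 * m + 1. (\<forall>a\<in>{p..<p + L}. \<not> A i j a) \<and>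
        (\<exists>a. mono_on {..<j} a \<and> (\<forall>t<j. A i t (a t) \<and> a t < p))"
      and right: "\<And>i. i < K \<Longrightarrow> \<exists>j<2 * m + 1. (\<forall>a\<in>{p..<p + L}. \<not> A i j a) \<and>
        (\<exists>a. mono_on {j<..<2 * m + 1} a \<and> (\<forall>t\<in>{j<..<2 * m + 1}. A i t (a t) \<and> p + L \<le> a t \<and> a t < T))"
      using stable_segment[of K "2 * m + 1" A L] no_full unfolding T_def[symmetric] by blast
    obtain jl where jl: "\<And>i. i < K \<Longrightarrow> jl i < 2 * m + 1 \<and> (\<forall>a\<in>{p..<p + L}. \<not> A i (jl i) a) \<and>
        (\<exists>a. mono_on {..<jl i} a \<and> (\<forall>t<jl i. A i t (a t) \<and> a t < p))"
      using left by metis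
    obtain jr where jr: "\<And>i. i < K \<Longrightarrow> jr i < 2 * m + 1 \<and> (\<forall>a\<in>{p..<p + L}. \<not> A i (jr i) a) \<and>
        (\<exists>a. mono_on {jr i<..<2 * m + 1} a \<and>
          (\<forall>t\<in>{jr i<..<2 * m + 1}. A i t (a t) \<and> p + L \<le> a t \<and> a t < T))"
      using right by metis
    \<comment> \<open>Both \<open>jl i\<close> and \<open>jr i\<close> are shapes hitting color
      \<open>i\<close> throughout the segment. With this preference \<open>J i = m\<close> forces
      both to be \<open>m\<close>, so that the two chains leave exactly the shape \<open>m\<close>
      to be filled in.\<close>
    define J where "J i = (if jl i = m then jr i else jl i)" for i
    define \<chi>' where "\<chi>' l s = \<chi> l (T + s - l)" for l s
    have \<chi>'_eq: "\<chi>' (a + x) (x + y) = \<chi> (a + x) (T - a + y)" if "a \<in> {p..<p + L}" for a x y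
    proof -
      have "T + (x + y) - (a + x) = T - a + y"
        using that p by simp
      then show ?thesis
        by (simp add: \<chi>'_def)
    qed
    obtain b where b: "b \<in> {p..<p + L}" "J (\<chi>' b m) = m"
      and corner: "\<And>x y. x \<le> m \<Longrightarrow> y \<le> m \<Longrightarrow> \<chi>' (b + x) (x + y) = \<chi>' b m \<Longrightarrow> x = 0 \<and> y = m"
    proof (rule unique_corner_color[of \<chi>' m J p L])
      show "\<chi>' l s < (m + 1)\<^sup>2" for l s
        using \<chi> by (simp add: \<chi>'_def K_def)
      show "J i \<le> 2 * m" if "i < (m + 1)\<^sup>2" for i
        using jl[of i] jr[of i] that by (simp add: J_def K_def)
      show "2 * m * (m + 1)\<^sup>2 < L"
        by (simp add: L_def K_def)
      fix i a assume ia: "i < (m + 1)\<^sup>2" "a \<in> {p..<p + L}"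
      then have "\<not> A i (J i) a"
        using jl[of i] jr[of i] by (simp add: J_def K_def)
      then show "\<exists>x\<le>J i. \<exists>y\<le>2 * m - J i. \<chi>' (a + x) (x + y) = i"
        unfolding A_def \<chi>'_eq[OF ia(2)] by blast
    qed blast
    define \<alpha> where "\<alpha> = \<chi>' b m"
    have \<alpha>: "\<alpha> < K"
      using \<chi> by (simp add: \<alpha>_def \<chi>'_def)
    have jm: "jl \<alpha> = m" "jr \<alpha> = m"
      using b(2) by (auto simp: J_def \<alpha>_def split: if_splits)
    obtain al where al: "mono_on {..<m} al" "\<And>t. t < m \<Longrightarrow> A \<alpha> t (al t) \<and> al t < p"
      using jl[OF \<alpha>] unfolding jm by blast
    obtain ar where ar: "mono_on {m<..<2 * m + 1} ar"
      "\<And>t. t \<in> {m<..<2 * m + 1} \<Longrightarrow> A \<alpha> t (ar t) \<and> p + L \<le> ar t \<and> ar t < T"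
      using jr[OF \<alpha>] unfolding jm by blast
    \<comment> \<open>The two chains lie on either side of the segment, so inserting
      \<open>b\<close> from inside it keeps the sequence monotone.\<close>
    define a where "a t = (if t < m then al t else if t = m then b else ar t)" for t
    have "mono_on {..2 * m} a"
    proof (rule mono_onI)
      fix r s assume rs: "r \<in> {..2 * m}" "s \<in> {..2 * m}" "r \<le> s"
      consider "s < m" | "r < m" "s = m" | "r < m" "m < s" | "r = m" "s = m" | "r = m" "m < s" | "m < r"
        using rs by linarith
      then show "a r \<le> a s"
      proof cases
        case 1
        then show ?thesis
          using rs mono_onD[OF al(1), of r s] by (simp add: a_def)
      next
        case 2
        then show ?thesis
          using al(2)[of r] b(1) by (simp add: a_def)
      next
        case 3
        then show ?thesis
          using al(2)[of r] ar(2)[of s] rs by (simp add: a_def)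
      next
        case 4
        then show ?thesis
          by simp
      next
        case 5
        then show ?thesis
          using ar(2)[of s] rs b(1) by (simp add: a_def)
      next
        case 6
        then show ?thesis
          using rs mono_onD[OF ar(1), of r s] by (simp add: a_def)
      qed
    qed
    moreover have "a j \<le> T" if "j \<le> 2 * m" for j
    proof -
      consider "j < m" | "j = m" | "m < j"
        by linarith
      then show ?thesis
      proof cases
        case 1
        then show ?thesis
          using al(2)[of j] p by (simp add: a_def)
      next
        case 2
        then show ?thesis
          using b(1) p by (simp add: a_def)
      next
        case 3
        then show ?thesis
          using ar(2)[of j] that by (simp add: a_def)
      qed
    qed
    moreover have "j = m \<and> x = 0 \<and> y = m"
      if j: "j \<le> 2 * m" and xy: "x \<le> j" "y \<le> 2 * m - j" and eq: "\<chi> (a j + x) (T - a j + y) = \<alpha>" for j x y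
    proof -
      have "\<not> A \<alpha> j (a j)"
        using xy eq unfolding A_def by blast
      then have "\<not> j < m" "\<not> m < j"
        using al(2)[of j] ar(2)[of j] j by (auto simp: a_def)
      then have "j = m"
        by simp
      then have "\<chi>' (b + x) (x + y) = \<chi>' b m"
        using eq \<chi>'_eq[OF b(1)] by (simp add: a_def \<alpha>_def)
      then show ?thesis
        using corner[of x y] xy \<open>j = m\<close> by simp
    qed
    ultimately show ?goal
      using \<alpha> unfolding K_def by blast
  qed
qed

section \<open>Reduction to simple colorings\<close>

lemma ramsey_finite_palette:
  fixes Pal :: "'p set" and q M :: nat
  assumes "finite Pal"
  shows "\<exists>N. \<forall>(W :: nat set) F. finite W \<longrightarrow> N \<le> card W \<longrightarrow> (\<forall>S\<in>nsets W q. F S \<in> Pal) \<longrightarrow>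
    (\<exists>T\<subseteq>W. card T = M \<and> (\<forall>S\<in>nsets T q. \<forall>S'\<in>nsets T q. F S = F S'))"
proof -
  let ?qs = "replicate (card Pal) M"
  obtain N :: nat where N: "partn_lst {..<N} ?qs q"
    using ramsey_full[of ?qs q] by blast
  obtain e where e: "bij_betw e Pal {0..<card Pal}"
    using ex_bij_betw_finite_nat[OF assms] by blast
  show ?thesis
  proof (intro exI[of _ N] allI impI)
    fix W :: "nat set" and F :: "nat set \<Rightarrow> 'p"
    assume W: "finite W" "N \<le> card W" and F: "\<forall>S\<in>nsets W q. F S \<in> Pal"
    obtain W0 where W0: "W0 \<subseteq> W" "card W0 = N" "finite W0"
      using obtain_subset_with_card_n[OF W(2)] by blast
    obtain g where g: "bij_betw g {0..<N} W0"
      using ex_bij_betw_nat_finite[OF W0(3)] W0(2) by blast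
    have g_inj: "inj_on g {..<N}" and g_img: "g ` {..<N} = W0"
      using g by (auto simp: bij_betw_def atLeast0LessThan)
    have FS: "F (g ` S) \<in> Pal" if "S \<in> nsets {..<N} q" for S
    proof -
      have "g ` S \<in> nsets W q"
        using that g_img W0(1) inj_on_subset[OF g_inj, of S]
        by (auto simp: nsets_def card_image)
      then show ?thesis
        using F by blast
    qed
    then have "(\<lambda>S. e (F (g ` S))) \<in> nsets {..<N} q \<rightarrow> {..<card Pal}"
      using e by (force simp: bij_betw_def)
    then obtain i H where i: "i < card Pal" and H: "H \<in> nsets {..<N} (?qs ! i)"
      and mono: "(\<lambda>S. e (F (g ` S))) ` nsets H q \<subseteq> {i}"
      by (rule partn_lstE[OF N]) auto
    have H': "H \<subseteq> {..<N}" "finite H" "card H = M"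
      using H i by (auto simp: nsets_def)
    have inj_H: "inj_on g H"
      using g_inj H'(1) inj_on_subset by blast
    have "F S = F S'" if SS: "S \<in> nsets (g ` H) q" "S' \<in> nsets (g ` H) q" for S S'
    proof -
      obtain U U' where U: "U \<in> nsets H q" "S = g ` U" "U' \<in> nsets H q" "S' = g ` U'"
        using nset_image_obtains[OF SS(1) inj_H] nset_image_obtains[OF SS(2) inj_H] by metis
      then have "e (F S) = e (F S')"
        using mono by blast
      moreover have "F S \<in> Pal" "F S' \<in> Pal"
        using U FS nsets_mono[OF H'(1)] by blast+
      ultimately show ?thesis
        using e by (auto simp: bij_betw_def inj_on_def)
    qed
    moreover have "g ` H \<subseteq> W" "card (g ` H) = M"
      using H' g_img W0(1) inj_H by (auto simp: card_image)
    ultimately show "\<exists>T\<subseteq>W. card T = M \<and> (\<forall>S\<in>nsets T q. \<forall>S'\<in>nsets T q. F S = F S')"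
      by blast
  qed
qed

text \<open>Sizes are treated from the largest down: the set found for size \<open>Suc Q\<close> is
  large enough for the smaller sizes, and homogeneity passes to subsets. For size 0 only the empty
  set occurs.\<close>

lemma ramsey_all_sizes:
  fixes Pal :: "nat \<Rightarrow> 'p set" and Q M :: nat
  assumes "\<And>q. finite (Pal q)"
  shows "\<exists>N. \<forall>(W :: nat set) F. finite W \<longrightarrow> N \<le> card W \<longrightarrow> (\<forall>q\<le>Q. \<forall>S\<in>nsets W q. F S \<in> Pal q) \<longrightarrow>
    (\<exists>T\<subseteq>W. card T = M \<and> (\<forall>q\<le>Q. \<forall>S\<in>nsets T q. \<forall>S'\<in>nsets T q. F S = F S'))"
proof (induction Q)
  case 0
  show ?case
  proof (intro exI[of _ M] allI impI)
    fix W :: "nat set" and F :: "nat set \<Rightarrow> 'p"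
    assume "M \<le> card W"
    then obtain T where "T \<subseteq> W" "card T = M"
      using obtain_subset_with_card_n by blast
    then show "\<exists>T\<subseteq>W. card T = M \<and> (\<forall>q\<le>0. \<forall>S\<in>nsets T q. \<forall>S'\<in>nsets T q. F S = F S')"
      by auto
  qed
next
  case (Suc Q)
  then obtain N1 where N1: "\<And>(W :: nat set) F. finite W \<Longrightarrow> N1 \<le> card W \<Longrightarrow>
    \<forall>q\<le>Q. \<forall>S\<in>nsets W q. F S \<in> Pal q \<Longrightarrow>
    \<exists>T\<subseteq>W. card T = M \<and> (\<forall>q\<le>Q. \<forall>S\<in>nsets T q. \<forall>S'\<in>nsets T q. F S = F S')"
    by metis
  obtain N where N: "\<And>(W :: nat set) F. finite W \<Longrightarrow> N \<le> card W \<Longrightarrow>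
    \<forall>S\<in>nsets W (Suc Q). F S \<in> Pal (Suc Q) \<Longrightarrow>
    \<exists>T\<subseteq>W. card T = N1 \<and> (\<forall>S\<in>nsets T (Suc Q). \<forall>S'\<in>nsets T (Suc Q). F S = F S')"
    using ramsey_finite_palette[OF assms, of "Suc Q" "Suc Q" N1] by metis
  show ?case
  proof (intro exI[of _ N] allI impI)
    fix W :: "nat set" and F :: "nat set \<Rightarrow> 'p"
    assume W: "finite W" "N \<le> card W" and F: "\<forall>q\<le>Suc Q. \<forall>S\<in>nsets W q. F S \<in> Pal q"
    obtain T1 where T1: "T1 \<subseteq> W" "card T1 = N1"
      "\<forall>S\<in>nsets T1 (Suc Q). \<forall>S'\<in>nsets T1 (Suc Q). F S = F S'"
      using N[OF W] F by blast
    have "finite T1" "\<forall>q\<le>Q. \<forall>S\<in>nsets T1 q. F S \<in> Pal q"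
      using T1(1) W(1) F nsets_mono[OF T1(1)] finite_subset le_SucI by blast+
    then obtain T where T: "T \<subseteq> T1" "card T = M"
      "\<forall>q\<le>Q. \<forall>S\<in>nsets T q. \<forall>S'\<in>nsets T q. F S = F S'"
      using N1[of T1 F] T1(2) by blast
    have "F S = F S'" if "q \<le> Suc Q" "S \<in> nsets T q" "S' \<in> nsets T q" for q S S'
    proof (cases "q = Suc Q")
      case True
      then show ?thesis
        using that T1(3) nsets_mono[OF T(1), of "Suc Q"] by blast
    next
      case False
      then have "q \<le> Q"
        using that(1) by simp
      then show ?thesis
        using T(3) that by blast
    qed
    moreover have "T \<subseteq> W"
      using T(1) T1(1) by blast
    ultimately show "\<exists>T\<subseteq>W. card T = M \<and> (\<forall>q\<le>Suc Q. \<forall>S\<in>nsets T q. \<forall>S'\<in>nsets T q. F S = F S')"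
      using T(2) by metis
  qed
qed

section \<open>Colorings determined by ranks\<close>

lemma card_less_inject:
  fixes S :: "nat set"
  assumes "finite S" "x \<in> S" "y \<in> S" "card {z \<in> S. z < x} = card {z \<in> S. z < y}"
  shows "x = y"
proof -
  have less: "card {z \<in> S. z < x} < card {z \<in> S. z < y}" if "x \<in> S" "x < y" for x y
  proof (rule psubset_card_mono)
    have "x \<in> {z \<in> S. z < y}" "x \<notin> {z \<in> S. z < x}"
      using that by auto
    moreover have "{z \<in> S. z < x} \<subseteq> {z \<in> S. z < y}"
      using that(2) by auto
    ultimately show "{z \<in> S. z < x} \<subset> {z \<in> S. z < y}"
      by blast
  qed (use assms(1) in simp)
  then show ?thesis
    using less[of x y] less[of y x] assms(2-4) by (cases x y rule: linorder_cases) simp_all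
qed

lemma card_less_greater:
  fixes S :: "nat set"
  assumes "finite S" "s \<in> S"
  shows "card S = Suc (card {x \<in> S. x < s} + card {x \<in> S. s < x})"
proof -
  have "S = insert s ({x \<in> S. x < s} \<union> {x \<in> S. s < x})"
  proof (rule set_eqI)
    fix x
    have "x < s \<or> x = s \<or> s < x"
      by (rule less_linear)
    then show "x \<in> S \<longleftrightarrow> x \<in> insert s ({x \<in> S. x < s} \<union> {x \<in> S. s < x})"
      using assms(2) by (elim disjE) simp_all
  qed
  then have "card S = card (insert s ({x \<in> S. x < s} \<union> {x \<in> S. s < x}))"
    by simp
  also have "\<dots> = Suc (card ({x \<in> S. x < s} \<union> {x \<in> S. s < x}))"
    using assms by (intro card_insert_disjoint) auto
  also have "card ({x \<in> S. x < s} \<union> {x \<in> S. s < x}) = card {x \<in> S. x < s} + card {x \<in> S. s < x}"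
    using assms by (intro card_Un_disjoint) auto
  finally show ?thesis .
qed

definition simple_on ::
    "nat \<Rightarrow> (bool list set \<Rightarrow> nat) \<Rightarrow> nat \<Rightarrow> (nat \<Rightarrow> nat) \<Rightarrow> (nat \<Rightarrow> nat \<Rightarrow> nat) \<Rightarrow> bool" where
  "simple_on n c M \<tau> \<chi> \<longleftrightarrow> strict_mono_on {..<M} \<tau> \<and> \<tau> ` {..<M} \<subseteq> {..<n} \<and>
     (\<forall>X\<subseteq>{..<M}. \<forall>i<M. i \<notin> X \<longrightarrow>
        c (cube_edge n (\<tau> i) (\<tau> ` X)) = \<chi> (card {x \<in> X. x < i}) (card {x \<in> X. i < x}))"

text \<open>An edge is read as its upper end \<open>S\<close> with its direction as a marked
  element. Ramsey's theorem makes the colors over all \<open>S\<close> of one size agree rank by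
  rank, and size and rank amount to the numbers of ones left and right of the direction.\<close>

lemma simple_subcube:
  fixes r M :: nat
  assumes "r > 0"
  shows "\<exists>N. \<forall>n\<ge>N. \<forall>c. (\<forall>e\<in>edges (hypercube n). c e < r) \<longrightarrow>
    (\<exists>\<tau> \<chi>. simple_on n c M \<tau> \<chi> \<and> (\<forall>l u. \<chi> l u < r))"
proof -
  define Pal :: "nat \<Rightarrow> (nat \<times> nat) set set" where "Pal q = Pow ({..<q} \<times> {..<r})" for q
  have "finite (Pal q)" for q
    by (simp add: Pal_def)
  from ramsey_all_sizes[of Pal M M, OF this] obtain N where N: "\<And>(W :: nat set) F. finite W \<Longrightarrow> N \<le> card W \<Longrightarrow>
    \<forall>q\<le>M. \<forall>S\<in>nsets W q. F S \<in> Pal q \<Longrightarrow>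
    \<exists>T\<subseteq>W. card T = M \<and> (\<forall>q\<le>M. \<forall>S\<in>nsets T q. \<forall>S'\<in>nsets T q. F S = F S')"
    by metis
  show ?thesis
  proof (intro exI[of _ N] allI impI)
    fix n c assume n: "n \<ge> N" and c: "\<forall>e\<in>edges (hypercube n). c e < r"
    \<comment> \<open>The map from ranks to colors is coded by its graph, an element of a finite
      palette.\<close>
    define F where "F S = (\<lambda>s. (card {x \<in> S. x < s}, c (cube_edge n s (S - {s})))) ` S" for S
    have col: "c (cube_edge n s (S - {s})) < r" if "S \<subseteq> {..<n}" "s \<in> S" for s S
    proof -
      have "cube_edge n s (S - {s}) \<in> edges (hypercube n)"
        using that by (intro cube_edge_in_edges) auto
      then show ?thesis
        using c by blast
    qed
    have "F S \<in> Pal q" if "S \<in> nsets {..<n} q" for q S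
    proof -
      have S: "S \<subseteq> {..<n}" "finite S" "card S = q"
        using that by (auto simp: nsets_def)
      have "card {x \<in> S. x < s} < q" if "s \<in> S" for s
        using card_less_greater[OF S(2) that] S(3) by simp
      then show ?thesis
        unfolding F_def Pal_def using col[OF S(1)] by auto
    qed
    then have "\<exists>T\<subseteq>{..<n}. card T = M \<and> (\<forall>q\<le>M. \<forall>S\<in>nsets T q. \<forall>S'\<in>nsets T q. F S = F S')"
      using n by (intro N) simp_all
    then obtain T where T: "T \<subseteq> {..<n}" "card T = M"
      and hom: "\<And>q S S'. q \<le> M \<Longrightarrow> S \<in> nsets T q \<Longrightarrow> S' \<in> nsets T q \<Longrightarrow> F S = F S'"
      by metis
    have "finite T"
      using T(1) finite_subset by blast
    have same: "c (cube_edge n s (S - {s})) = c (cube_edge n s' (S' - {s'}))"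
      if S: "S \<subseteq> T" "s \<in> S" "S' \<subseteq> T" "s' \<in> S'"
        and eq: "card {x \<in> S. x < s} = card {x \<in> S'. x < s'}" "card {x \<in> S. s < x} = card {x \<in> S'. s' < x}"
      for S s S' s'
    proof -
      have fin: "finite S" "finite S'"
        using S \<open>finite T\<close> finite_subset by blast+
      then have "card S = card S'"
        using card_less_greater[of S s] card_less_greater[of S' s'] S eq by simp
      moreover have "card S \<le> M"
        using card_mono[OF \<open>finite T\<close> S(1)] T(2) by simp
      ultimately have "F S = F S'"
        using hom[of "card S" S S'] S fin by (simp add: nsets_def)
      moreover have "(card {x \<in> S. x < s}, c (cube_edge n s (S - {s}))) \<in> F S"
        unfolding F_def using S by blast
      ultimately obtain t where t: "t \<in> S'" "card {x \<in> S'. x < t} = card {x \<in> S. x < s}"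
        "c (cube_edge n t (S' - {t})) = c (cube_edge n s (S - {s}))"
        unfolding F_def by force
      then have "t = s'"
        using card_less_inject[OF fin(2), of t s'] S eq by simp
      then show ?thesis
        using t by simp
    qed
    define P where "P l u p \<longleftrightarrow> fst p \<subseteq> T \<and> snd p \<in> fst p \<and>
        card {x \<in> fst p. x < snd p} = l \<and> card {x \<in> fst p. snd p < x} = u" for l u p
    \<comment> \<open>Pairs not realized inside \<open>T\<close> get color 0, which keeps all values
      below \<open>r\<close>.\<close>
    define \<chi> where "\<chi> l u = (if \<exists>p. P l u p
        then c (cube_edge n (snd (SOME p. P l u p)) (fst (SOME p. P l u p) - {snd (SOME p. P l u p)}))
        else 0)" for l u
    have \<chi>_eq: "\<chi> l u = c (cube_edge n s (S - {s}))" if "P l u (S, s)" for l u S s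
    proof -
      have "P l u (SOME p. P l u p)"
        using that by (rule someI)
      then show ?thesis
        using that same[of "fst (SOME p. P l u p)" "snd (SOME p. P l u p)" S s]
        unfolding \<chi>_def P_def by auto
    qed
    have \<chi>_less: "\<chi> l u < r" for l u
    proof (cases "\<exists>p. P l u p")
      case True
      then obtain S s where Ss: "P l u (S, s)"
        by auto
      then have "S \<subseteq> {..<n}" "s \<in> S"
        using T(1) by (auto simp: P_def)
      then show ?thesis
        using \<chi>_eq[OF Ss] col by simp
    next
      case False
      then show ?thesis
        using assms by (simp add: \<chi>_def)
    qed
    obtain \<tau> where \<tau>: "bij_betw \<tau> {..<M} T" and \<tau>_mono: "strict_mono_on {..<M} \<tau>"
      using ex_bij_betw_strict_mono_card[OF \<open>finite T\<close>] T(2) by metis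
    have \<tau>_inj: "inj_on \<tau> {..<M}" and \<tau>_img: "\<tau> ` {..<M} = T"
      using \<tau> by (auto simp: bij_betw_def)
    have "c (cube_edge n (\<tau> i) (\<tau> ` X)) = \<chi> (card {x \<in> X. x < i}) (card {x \<in> X. i < x})"
      if X: "X \<subseteq> {..<M}" and i: "i < M" "i \<notin> X" for X i
    proof -
      let ?S = "insert (\<tau> i) (\<tau> ` X)"
      have less: "\<tau> x < \<tau> y \<longleftrightarrow> x < y" if "x < M" "y < M" for x y
        using strict_mono_on_less[OF \<tau>_mono] that by simp
      have "{x \<in> ?S. x < \<tau> i} = \<tau> ` {x \<in> X. x < i}" "{x \<in> ?S. \<tau> i < x} = \<tau> ` {x \<in> X. i < x}"
        using less X i by auto
      moreover have "card (\<tau> ` Y) = card Y" if "Y \<subseteq> X" for Y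
        using that X \<tau>_inj by (meson card_image inj_on_subset)
      ultimately have "card {x \<in> ?S. x < \<tau> i} = card {x \<in> X. x < i}"
        "card {x \<in> ?S. \<tau> i < x} = card {x \<in> X. i < x}"
        by auto
      moreover have "?S \<subseteq> T"
        using \<tau>_img X i by auto
      ultimately have "P (card {x \<in> X. x < i}) (card {x \<in> X. i < x}) (?S, \<tau> i)"
        unfolding P_def by simp
      moreover have "\<tau> i \<notin> \<tau> ` X"
        using \<tau>_inj X i by (meson inj_on_image_mem_iff lessThan_iff)
      then have "?S - {\<tau> i} = \<tau> ` X"
        by simp
      ultimately show ?thesis
        using \<chi>_eq by metis
    qed
    then have "simple_on n c M \<tau> \<chi>"
      using \<tau>_mono \<tau>_img T(1) by (simp add: simple_on_def)
    then show "\<exists>\<tau> \<chi>. simple_on n c M \<tau> \<chi> \<and> (\<forall>l u. \<chi> l u < r)"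
      using \<chi>_less by blast
  qed
qed

section \<open>The upper bound\<close>

text \<open>The shape sequence gives a subcube with at most one edge of color
  \<open>\<alpha>\<close>, and \<open>G\<close> is embedded so that its missing edge
  \<open>e0\<close> falls there.\<close>

lemma not_polychromatic_missing_edge:
  fixes G :: "bool list graph" and m :: nat
  assumes G: "subgraph G (hypercube (2 * m + 1))"
    and e0: "e0 \<in> edges (hypercube (2 * m + 1))" "e0 \<notin> edges G"
  shows "\<not> polychromatic G ((m + 1)\<^sup>2)"
proof
  assume poly: "polychromatic G ((m + 1)\<^sup>2)"
  let ?d = "2 * m + 1" and ?K = "(m + 1)\<^sup>2"
  obtain T where T: "\<And>\<chi> :: nat \<Rightarrow> nat \<Rightarrow> nat. (\<And>l r. \<chi> l r < ?K) \<Longrightarrow>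
    \<exists>\<alpha><?K. \<exists>a. mono_on {..2 * m} a \<and> (\<forall>j\<le>2 * m. a j \<le> T) \<and>
      (\<forall>j\<le>2 * m. \<forall>x\<le>j. \<forall>y\<le>2 * m - j. \<chi> (a j + x) (T - a j + y) = \<alpha> \<longrightarrow> j = m \<and> x = 0 \<and> y = m)"
    using shape_sequence_missing_color[of m] by metis
  \<comment> \<open>Room for \<open>T\<close> fixed ones and the \<open>2 * m + 1\<close>
    stars.\<close>
  define M where "M = T + ?d"
  have "?K > 0"
    by simp
  then obtain N where N: "\<forall>n\<ge>N. \<forall>c. (\<forall>e\<in>edges (hypercube n). c e < ?K) \<longrightarrow>
      (\<exists>\<tau> \<chi>. simple_on n c M \<tau> \<chi> \<and> (\<forall>l u. \<chi> l u < ?K))"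
    using simple_subcube by blast
  define n where "n = max N ?d"
  have "embedding G n \<lparr>verts = subcube_map n {} id (\<lambda>_. False) ?d ` verts G,
      edges = (`) (subcube_map n {} id (\<lambda>_. False) ?d) ` edges G\<rparr>"
    by (rule embedding_subcube_map) (use G in \<open>auto simp: n_def\<close>)
  moreover have "n \<ge> 1"
    by (simp add: n_def)
  ultimately obtain c where c: "polychromatic_coloring G n ?K c"
    using poly unfolding polychromatic_def by blast
  have "n \<ge> N"
    by (simp add: n_def)
  moreover have "\<forall>e\<in>edges (hypercube n). c e < ?K"
    using c unfolding polychromatic_coloring_def by (rule conjunct1)
  ultimately obtain \<tau> \<chi> where simple: "simple_on n c M \<tau> \<chi>" and \<chi>: "\<forall>l u. \<chi> l u < ?K"
    using N by blast
  have \<tau>: "strict_mono_on {..<M} \<tau>" "\<tau> ` {..<M} \<subseteq> {..<n}"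
    using simple by (auto simp: simple_on_def)
  have color: "c (cube_edge n (\<tau> i) (\<tau> ` X)) = \<chi> (card {x \<in> X. x < i}) (card {x \<in> X. i < x})"
    if "X \<subseteq> {..<M}" "i < M" "i \<notin> X" for X i
    using simple that by (simp add: simple_on_def)
  have \<tau>_inj: "inj_on \<tau> {..<M}"
    using \<tau>(1) by (rule strict_mono_on_imp_inj_on)
  obtain \<alpha> a where \<alpha>: "\<alpha> < ?K" and a: "mono_on {..2 * m} a" "\<forall>j\<le>2 * m. a j \<le> T"
    "\<forall>j\<le>2 * m. \<forall>x\<le>j. \<forall>y\<le>2 * m - j.
      \<chi> (a j + x) (T - a j + y) = \<alpha> \<longrightarrow> j = m \<and> x = 0 \<and> y = m"
    using T[of \<chi>] \<chi> by (elim meta_impE exE conjE) simp_all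
  have a_mono: "a s \<le> a t" if "s \<le> t" "t \<le> 2 * m" for s t
    using mono_onD[OF a(1), of s t] that by simp
  have a_le: "a j \<le> T" if "j \<le> 2 * m" for j
    using a(2) that by simp
  have missing: "j = m \<and> x = 0 \<and> y = m"
    if "j \<le> 2 * m" "x \<le> j" "y \<le> 2 * m - j" "\<chi> (a j + x) (T - a j + y) = \<alpha>" for j x y
    using a(3) that by simp
  \<comment> \<open>With \<open>t\<close> earlier stars in front of it, star \<open>t\<close> has
    exactly \<open>a t\<close> fixed ones to its left.\<close>
  define star where "star t = a t + t" for t
  have star_less: "star s < star t \<longleftrightarrow> s < t" if "s < ?d" "t < ?d" for s t
  proof -
    have "star s < star t" if "s < t" "t < ?d" for s t
      using a_mono[of s t] that by (simp add: star_def)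
    then show ?thesis
      using that by (metis linorder_neqE_nat order_less_asym)
  qed
  have star_inj: "inj_on star {..<?d}"
    using star_less by (intro inj_onI) (metis lessThan_iff linorder_neqE_nat order_less_irrefl)
  have star_M: "star t < M" if "t < ?d" for t
    using a_le[of t] that by (simp add: star_def M_def)
  define O1 where "O1 = {..<M} - star ` {..<?d}"
  have O1: "finite O1" "O1 \<subseteq> {..<M}" "O1 \<inter> star ` {..<?d} = {}"
    by (auto simp: O1_def)
  have M_eq: "{..<M} = O1 \<union> star ` {..<?d}"
    using star_M by (auto simp: O1_def)
  have below: "card {x \<in> O1. x < star j} = a j" if "j < ?d" for j
  proof -
    have "{z \<in> {..<M}. z < star j} = {..<star j}"
      using star_M[OF that] by auto
    then have "star j = card {z \<in> {..<M}. z < star j}"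
      by simp
    also have "\<dots> = card {x \<in> O1. x < star j} + card {t \<in> {..<?d}. star t < star j}"
      unfolding M_eq using O1 star_inj by (intro card_split_image) auto
    also have "{t \<in> {..<?d}. star t < star j} = {..<j}"
      using star_less that by auto
    finally show ?thesis
      by (simp add: star_def)
  qed
  have above: "card {x \<in> O1. star j < x} = T - a j" if "j < ?d" for j
  proof -
    have "{z \<in> {..<M}. star j < z} = {star j<..<M}"
      by auto
    then have "M - Suc (star j) = card {z \<in> {..<M}. star j < z}"
      by simp
    also have "\<dots> = card {x \<in> O1. star j < x} + card {t \<in> {..<?d}. star j < star t}"
      unfolding M_eq using O1 star_inj by (intro card_split_image) auto
    also have "{t \<in> {..<?d}. star j < star t} = {j<..<?d}"
      using star_less that by auto
    finally show ?thesis
      using that by (simp add: star_def M_def)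
  qed
  obtain i0 X0 where i0: "i0 < ?d" "X0 \<subseteq> {..<?d}" "i0 \<notin> X0" "e0 = cube_edge ?d i0 X0"
    using e0(1) by (rule edges_hypercubeE)
  \<comment> \<open>The subcube is placed so that \<open>e0\<close> becomes the edge in the direction of the middle star
    with all stars to the left 0 and all stars to the right 1.\<close>
  define \<pi> where "\<pi> = Transposition.transpose i0 m"
  have \<pi>_less: "\<pi> t < ?d \<longleftrightarrow> t < ?d" for t
    using i0(1) by (auto simp: \<pi>_def Transposition.transpose_def)
  have \<pi>_inj: "\<pi> s = \<pi> t \<longleftrightarrow> s = t" for s t
    unfolding \<pi>_def by (metis Transposition.transpose_involutory)
  have \<pi>_m: "\<pi> t = m \<longleftrightarrow> t = i0" for t
    by (auto simp: \<pi>_def Transposition.transpose_def)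
  define \<rho> where "\<rho> = \<tau> \<circ> star \<circ> \<pi>"
  define u where "u t \<longleftrightarrow> (t \<in> X0) \<noteq> (m < \<pi> t)" for t
  define \<phi> where "\<phi> = subcube_map n (\<tau> ` O1) \<rho> u ?d"
  have "embedding G n \<lparr>verts = \<phi> ` verts G, edges = (`) \<phi> ` edges G\<rparr>"
    unfolding \<phi>_def
  proof (rule embedding_subcube_map)
    show "\<tau> ` O1 \<subseteq> {..<n}"
      using O1(2) \<tau>(2) by blast
    show "inj_on \<rho> {..<?d}"
    proof (rule inj_onI)
      fix s t assume st: "s \<in> {..<?d}" "t \<in> {..<?d}" "\<rho> s = \<rho> t"
      then have "star (\<pi> s) = star (\<pi> t)"
        using inj_onD[OF \<tau>_inj, of "star (\<pi> s)" "star (\<pi> t)"] star_M \<pi>_less by (auto simp: \<rho>_def)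
      then have "\<pi> s = \<pi> t"
        using inj_onD[OF star_inj, of "\<pi> s" "\<pi> t"] st \<pi>_less by auto
      then show "s = t"
        using \<pi>_inj by blast
    qed
    show "\<rho> ` {..<?d} \<subseteq> {..<n} - \<tau> ` O1"
    proof
      fix z assume "z \<in> \<rho> ` {..<?d}"
      then obtain t where t: "t < ?d" "z = \<tau> (star (\<pi> t))"
        by (auto simp: \<rho>_def)
      then have "star (\<pi> t) < M" "star (\<pi> t) \<notin> O1"
        using star_M[of "\<pi> t"] \<pi>_less O1(3) by auto
      then show "z \<in> {..<n} - \<tau> ` O1"
        using t(2) \<tau>(2) \<tau>_inj O1(2) by (auto dest: inj_onD)
    qed
  qed (rule G)
  then obtain e where e: "e \<in> edges G" "c (\<phi> ` e) = \<alpha>"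
    using c \<alpha> unfolding polychromatic_coloring_def by fastforce
  have "e \<in> edges (hypercube ?d)"
    using e(1) G by (auto simp: subgraph_def)
  then obtain j X where jX: "j < ?d" "X \<subseteq> {..<?d}" "j \<notin> X" "e = cube_edge ?d j X"
    by (rule edges_hypercubeE)
  define Y where "Y = \<pi> ` {t. t < ?d \<and> t \<noteq> j \<and> (t \<in> X) \<noteq> u t}"
  have Y_mem: "\<pi> t \<in> Y \<longleftrightarrow> t < ?d \<and> t \<noteq> j \<and> (t \<in> X) \<noteq> u t" for t
    unfolding Y_def by (auto simp: \<pi>_inj)
  have Y: "Y \<subseteq> {..<?d}" "finite Y" "\<pi> j \<notin> Y"
    unfolding Y_def using \<pi>_less \<pi>_inj by auto
  have Y_star: "inj_on star Y" "O1 \<inter> star ` Y = {}"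
    using Y(1) star_inj O1(3) inj_on_subset by blast+
  have pj: "\<pi> j < ?d"
    using jX(1) \<pi>_less by simp
  define Z where "Z = O1 \<union> star ` Y"
  have "\<phi> ` e = cube_edge n (\<tau> (star (\<pi> j))) (\<tau> ` Z)"
    unfolding jX(4) \<phi>_def image_subcube_map[OF jX(1-3)] Z_def Y_def
    by (simp only: \<rho>_def o_apply image_Un image_comp comp_assoc)
  moreover have "Z \<subseteq> {..<M}"
    using O1(2) Y(1) star_M unfolding Z_def by auto
  moreover have "star (\<pi> j) \<notin> Z"
    using Y(1,3) pj O1(3) star_inj unfolding Z_def by (auto dest: inj_onD)
  ultimately have "\<chi> (card {x \<in> Z. x < star (\<pi> j)}) (card {x \<in> Z. star (\<pi> j) < x}) = \<alpha>"
    using color[of Z "star (\<pi> j)"] star_M[OF pj] e(2) by simp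
  moreover have "{y \<in> Y. star y < star (\<pi> j)} = {y \<in> Y. y < \<pi> j}" "{y \<in> Y. star (\<pi> j) < star y} = {y \<in> Y. \<pi> j < y}"
    using star_less Y(1) pj by auto
  then have "card {x \<in> Z. x < star (\<pi> j)} = a (\<pi> j) + card {y \<in> Y. y < \<pi> j}"
    "card {x \<in> Z. star (\<pi> j) < x} = T - a (\<pi> j) + card {y \<in> Y. \<pi> j < y}"
    unfolding Z_def card_split_image[OF O1(1) Y(2) Y_star] by (simp_all add: below[OF pj] above[OF pj])
  moreover have card_le: "card {y \<in> Y. y < \<pi> j} \<le> \<pi> j" "card {y \<in> Y. \<pi> j < y} \<le> 2 * m - \<pi> j"
  proof -
    have "card {y \<in> Y. y < \<pi> j} \<le> card {..<\<pi> j}"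
      by (rule card_mono) auto
    then show "card {y \<in> Y. y < \<pi> j} \<le> \<pi> j"
      by simp
    have "card {y \<in> Y. \<pi> j < y} \<le> card {\<pi> j<..2 * m}"
      using Y(1) by (intro card_mono) auto
    then show "card {y \<in> Y. \<pi> j < y} \<le> 2 * m - \<pi> j"
      by simp
  qed
  \<comment> \<open>The counts around star \<open>\<pi> j\<close> form a cell of its rectangle, so
    \<open>missing\<close> applies. Zero ones on the left and \<open>m\<close> on the right then
    determine \<open>Y\<close>.\<close>
  ultimately have *: "\<pi> j = m" "card {y \<in> Y. y < \<pi> j} = 0" "card {y \<in> Y. \<pi> j < y} = m"
    using missing[of "\<pi> j" "card {y \<in> Y. y < \<pi> j}" "card {y \<in> Y. \<pi> j < y}"] pj by auto
  then have not_left: "y \<notin> Y" if "y < m" for y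
    using Y(2) that by auto
  have "{y \<in> Y. m < y} = {m<..2 * m}"
    using * Y(1) by (intro card_subset_eq) auto
  then have right_eq: "y \<in> {y \<in> Y. m < y} \<longleftrightarrow> y \<in> {m<..2 * m}" for y
    by (simp only:)
  have right: "y \<in> Y \<longleftrightarrow> y \<le> 2 * m" if "m < y" for y
    using right_eq[of y] that by simp
  have Y_iff: "y \<in> Y \<longleftrightarrow> m < y \<and> y < ?d" for y
    using not_left[of y] right[of y] Y(3) *(1) by (cases y m rule: linorder_cases) auto
  have "t \<in> X \<longleftrightarrow> t \<in> X0" for t
  proof (cases "t < ?d \<and> t \<noteq> i0")
    case True
    then have "((t \<in> X) \<noteq> u t) \<longleftrightarrow> m < \<pi> t"
      using Y_mem[of t] Y_iff[of "\<pi> t"] \<pi>_less[of t] *(1) \<pi>_m[of j] by auto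
    then show ?thesis
      by (auto simp: u_def)
  next
    case False
    then show ?thesis
      using jX i0 *(1) \<pi>_m[of j] by auto
  qed
  then have "X = X0"
    by blast
  then have "e = e0"
    using jX(4) i0(4) *(1) \<pi>_m by simp
  then show False
    using e(1) e0(2) by simp
qed

section \<open>Combination of the two bounds\<close>

lemma polychromatic_fewer_colors:
  assumes "polychromatic G r" "0 < r'" "r' \<le> r"
  shows "polychromatic G r'"
  unfolding polychromatic_def
proof (intro allI impI)
  fix n :: nat assume "n \<ge> 1" "\<exists>H. embedding G n H"
  then obtain c where c: "polychromatic_coloring G n r c"
    using assms(1) unfolding polychromatic_def by blast
  have "polychromatic_coloring G n r' (\<lambda>e. min (c e) (r' - 1))"
    unfolding polychromatic_coloring_def
  proof (intro conjI ballI allI impI)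
    show "min (c e) (r' - 1) < r'" for e
      using assms(2) by linarith
    fix H i assume H: "embedding G n H" and i: "i < r'"
    then obtain e where "e \<in> edges H" "c e = i"
      using c assms(3) unfolding polychromatic_coloring_def by (meson order_less_le_trans)
    then show "\<exists>e\<in>edges H. min (c e) (r' - 1) = i"
      using i by (intro bexI[of _ e]) auto
  qed
  then show "\<exists>c. polychromatic_coloring G n r' c"
    by blast
qed

text \<open>Both graphs of the theorem lie between the cube less a vertex, which gives the lower
  bound, and the cube less an edge, which gives the upper bound.\<close>

lemma polychromatic_number_punctured:
  fixes G :: "bool list graph" and m :: nat
  assumes "m \<ge> 1" and v: "length v = 2 * m + 1"
    and "verts (hypercube (2 * m + 1)) - {v} \<subseteq> verts G"
    and "{e \<in> edges (hypercube (2 * m + 1)). v \<notin> e} \<subseteq> edges G"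
    and "subgraph G (hypercube (2 * m + 1))"
    and "e0 \<in> edges (hypercube (2 * m + 1))" "e0 \<notin> edges G"
  shows "polychromatic_number G = m * (m + 2)"
  unfolding polychromatic_number_def
proof (rule Greatest_equality)
  show "polychromatic G (m * (m + 2))"
    using assms by (intro polychromatic_punctured)
  fix r assume r: "polychromatic G r"
  show "r \<le> m * (m + 2)"
  proof (rule ccontr)
    assume "\<not> r \<le> m * (m + 2)"
    then have le: "(m + 1)\<^sup>2 \<le> r"
      by (simp add: power2_eq_square)
    have "polychromatic G ((m + 1)\<^sup>2)"
      by (rule polychromatic_fewer_colors[OF r _ le]) simp
    then show False
      using not_polychromatic_missing_edge assms(5-7) by blast
  qed
qed

theorem theorem10:
  fixes k :: nat and v :: "bool list" and e :: "bool list set"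
  assumes "k \<ge> 2"
    and "v \<in> verts (hypercube (2 * k - 1))"
    and "e \<in> edges (hypercube (2 * k - 1))"
  shows "polychromatic_number (delete_vertex (hypercube (2 * k - 1)) v) = k\<^sup>2 - 1 \<and>
         polychromatic_number (delete_edge (hypercube (2 * k - 1)) e) = k\<^sup>2 - 1"
proof
  define m where "m = k - 1"
  have m: "m \<ge> 1" "2 * k - 1 = 2 * m + 1" and k: "k = m + 1"
    using assms(1) by (auto simp: m_def)
  have k2: "k\<^sup>2 - 1 = m * (m + 2)"
    by (simp add: k power2_eq_square)
  let ?d = "2 * m + 1"
  have simple: "\<And>e. e \<in> edges (hypercube ?d) \<Longrightarrow> e \<subseteq> verts (hypercube ?d) \<and> card e = 2"
    using simple_hypercube unfolding simple_graph_def by blast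
  show "polychromatic_number (delete_vertex (hypercube (2 * k - 1)) v) = k\<^sup>2 - 1"
    unfolding m(2) k2
  proof (rule polychromatic_number_punctured[OF m(1)])
    show "length v = ?d"
      using assms(2) m by (simp add: hypercube_def)
    define X where "X = {i. i < ?d \<and> v ! i}"
    have v: "v = vec ?d X"
      using \<open>length v = ?d\<close> by (simp add: X_def vec_Collect_nth)
    \<comment> \<open>An edge at \<open>v\<close> has to serve as the missing edge; the one in
      direction 0 is taken.\<close>
    have "v \<in> cube_edge ?d 0 (X - {0})"
      unfolding v cube_edge_def by (cases "0 \<in> X") (simp_all add: insert_absorb)
    then show "cube_edge ?d 0 (X - {0}) \<notin> edges (delete_vertex (hypercube ?d) v)"
      by (simp add: delete_vertex_def)
    show "cube_edge ?d 0 (X - {0}) \<in> edges (hypercube ?d)"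
      by (rule cube_edge_in_edges) (auto simp: X_def)
    show "subgraph (delete_vertex (hypercube ?d) v) (hypercube ?d)"
      unfolding subgraph_def simple_graph_def using simple by (auto simp: delete_vertex_def)
  qed (auto simp: delete_vertex_def)
  \<comment> \<open>Deleting an end \<open>w\<close> of \<open>e\<close> removes \<open>e\<close>
    too, so the cube less \<open>w\<close> is contained in the cube less \<open>e\<close>.\<close>
  obtain w where w: "w \<in> e"
    using simple assms(3) m by fastforce
  show "polychromatic_number (delete_edge (hypercube (2 * k - 1)) e) = k\<^sup>2 - 1"
    unfolding m(2) k2
  proof (rule polychromatic_number_punctured[OF m(1)])
    show "length w = ?d"
      using w simple[of e] assms(3) m by (auto simp: hypercube_def)
    show "e \<in> edges (hypercube ?d)"
      using assms(3) m by simp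
    show "subgraph (delete_edge (hypercube ?d) e) (hypercube ?d)"
      unfolding subgraph_def simple_graph_def using simple by (auto simp: delete_edge_def)
  qed (use w in \<open>auto simp: delete_edge_def\<close>)
qed

end
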